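(* Suppose $\alpha$ and $\beta$ are real. Then the operator $T$ defined by $$f(z)=\sum_m a_mz^m\ \mapsto\ Tf(z)=f(0)+\sum_{|m|>0}a_m|m|^{\alpha-\beta}z^m$$ is an invertible operator from $\Lambda_\alpha$ onto $\Lambda_\beta$.
   Context: Fix a positive integer $n$. $\mathbb B_n$ is the open unit ball of $\mathbb C^n$; $f(z)=\sum_m a_mz^m$ denotes the Taylor series of a holomorphic function in $\mathbb B_n$ over multi-indices $m=(m_1,\dots,m_n)$ of nonnegative integers, with $|m|=m_1+\cdots+m_n$ and $z^m=z_1^{m_1}\cdots z_n^{m_n}$. The radial derivative is $Rf(z)=\sum_{k=1}^n z_k\frac{\partial f}{\partial z_k}(z)$, $R^k$ is its $k$-fold iterate, $R^0f=f$. For real $\alpha$, $\Lambda_\alpha$ is the space of holomorphic $f$ in $\mathbb B_n$ such that for some nonnegative integer $k>\alpha$ (equivalently, every such $k$) the function $(1-|z|^2)^{k-\alpha}R^kf(z)$ is bounded in $\mathbb B_n$; it is a Banach space with norm $\|f\|_\alpha=|f(0)|+\sup_{z\in\mathbb B_n}(1-|z|^2)^{k-\alpha}|R^kf(z)|$, where $k$ is the smallest nonnegative integer greater than $\alpha$. An invertible operator is a bounded linear bijection with bounded inverse. *)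

theory Defs
  imports "HOL-Analysis.Analysis"
begin

abbreviation unit_ball :: "(complex ^ 'n) set" where
  "unit_ball \<equiv> ball 0 1"

(* Complex Frechet differentiability: the real derivative exists and is complex linear. *)
definition holo_on :: "(complex ^ 'n \<Rightarrow> complex) \<Rightarrow> (complex ^ 'n) set \<Rightarrow> bool" where
  "holo_on f S \<longleftrightarrow>
     (\<forall>z\<in>S. \<exists>D. (f has_derivative D) (at z) \<and> (\<forall>c v. D (c *s v) = c * D v))"

definition partial_deriv :: "'n \<Rightarrow> (complex ^ 'n \<Rightarrow> complex) \<Rightarrow> complex ^ 'n \<Rightarrow> complex" where
  "partial_deriv k f z = deriv (\<lambda>w. f (z + axis k w)) 0"

definition radial_deriv :: "(complex ^ 'n \<Rightarrow> complex) \<Rightarrow> complex ^ 'n \<Rightarrow> complex" where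
  "radial_deriv f z = (\<Sum>k\<in>UNIV. z $ k * partial_deriv k f z)"

definition mi_size :: "('n::finite \<Rightarrow> nat) \<Rightarrow> nat" where
  "mi_size m = (\<Sum>k\<in>UNIV. m k)"

definition mi_power :: "complex ^ 'n \<Rightarrow> ('n \<Rightarrow> nat) \<Rightarrow> complex" where
  "mi_power z m = (\<Prod>k\<in>UNIV. (z $ k) ^ m k)"

(* The coefficient family of the power series with sum f in the unit ball.  For f holomorphic
   in the ball this family exists, with absolute convergence throughout the ball, and is unique. *)
definition taylor_coeffs :: "(complex ^ 'n \<Rightarrow> complex) \<Rightarrow> ('n \<Rightarrow> nat) \<Rightarrow> complex" where
  "taylor_coeffs f =
     (THE a. \<forall>z\<in>unit_ball. ((\<lambda>m. a m * mi_power z m) has_sum f z) UNIV)"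

(* A function on the ball is represented by its extension by 0 to the whole space, so that
   equality in Lipschitz_space is equality of functions on the ball. *)
definition Lipschitz_space :: "real \<Rightarrow> (complex ^ 'n \<Rightarrow> complex) set" where
  "Lipschitz_space \<alpha> =
     {f. holo_on f unit_ball \<and> (\<forall>z. z \<notin> unit_ball \<longrightarrow> f z = 0) \<and>
         (\<exists>k::nat. real k > \<alpha> \<and>
            bounded ((\<lambda>z. complex_of_real ((1 - (norm z)\<^sup>2) powr (real k - \<alpha>)) *
                          (radial_deriv ^^ k) f z) ` unit_ball))}"

definition Lipschitz_norm :: "real \<Rightarrow> (complex ^ 'n \<Rightarrow> complex) \<Rightarrow> real" where
  "Lipschitz_norm \<alpha> f =
     (let k = (LEAST k::nat. real k > \<alpha>) in
        cmod (f 0) +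
        (SUP z\<in>unit_ball. (1 - (norm z)\<^sup>2) powr (real k - \<alpha>) * cmod ((radial_deriv ^^ k) f z)))"

definition bounded_operator ::
  "('a \<Rightarrow> complex) set \<Rightarrow> (('a \<Rightarrow> complex) \<Rightarrow> real) \<Rightarrow>
   ('b \<Rightarrow> complex) set \<Rightarrow> (('b \<Rightarrow> complex) \<Rightarrow> real) \<Rightarrow>
   (('a \<Rightarrow> complex) \<Rightarrow> ('b \<Rightarrow> complex)) \<Rightarrow> bool" where
  "bounded_operator V nV W nW T \<longleftrightarrow>
     (\<forall>f\<in>V. T f \<in> W) \<and>
     (\<forall>f\<in>V. \<forall>g\<in>V. T (\<lambda>x. f x + g x) = (\<lambda>x. T f x + T g x)) \<and>
     (\<forall>c. \<forall>f\<in>V. T (\<lambda>x. c * f x) = (\<lambda>x. c * T f x)) \<and>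
     (\<exists>C. \<forall>f\<in>V. nW (T f) \<le> C * nV f)"

definition invertible_operator ::
  "('a \<Rightarrow> complex) set \<Rightarrow> (('a \<Rightarrow> complex) \<Rightarrow> real) \<Rightarrow>
   ('b \<Rightarrow> complex) set \<Rightarrow> (('b \<Rightarrow> complex) \<Rightarrow> real) \<Rightarrow>
   (('a \<Rightarrow> complex) \<Rightarrow> ('b \<Rightarrow> complex)) \<Rightarrow> bool" where
  "invertible_operator V nV W nW T \<longleftrightarrow>
     bounded_operator V nV W nW T \<and> bij_betw T V W \<and>
     bounded_operator W nW V nV (inv_into V T)"

definition coeff_multiplier ::
  "real \<Rightarrow> real \<Rightarrow> (complex ^ 'n \<Rightarrow> complex) \<Rightarrow> complex ^ 'n \<Rightarrow> complex" where
  "coeff_multiplier \<alpha> \<beta> f z =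
     (if z \<in> unit_ball
      then f 0 + (\<Sum>\<^sub>\<infinity>m\<in>{m. mi_size m > 0}.
             taylor_coeffs f m * complex_of_real (real (mi_size m) powr (\<alpha> - \<beta>)) * mi_power z m)
      else 0)"

end

theory Submission
  imports Defs "HOL-Complex_Analysis.Complex_Analysis"
begin

text \<open>Group the Taylor series of a holomorphic function \<open>f\<close> by degree, \<open>f = \<Sum>\<^sub>j f\<^sub>j\<close> with \<open>f\<^sub>j\<close> a
homogeneous polynomial of degree \<open>j\<close>. Euler's identity makes the radial derivative \<open>R\<close> the diagonal
operator that multiplies \<open>f\<^sub>j\<close> by \<open>j\<close>, and the operator of the theorem multiplies \<open>f\<^sub>j\<close> by
\<open>j powr (\<alpha> - \<beta>)\<close>. All these operators commute, so for \<open>k > \<alpha>\<close> and \<open>l > \<beta>\<close> the function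
\<open>R\<^sup>l (T f)\<close> arises from \<open>h = R\<^sup>k f\<close>, up to the constant term, through the multiplier \<open>j powr s\<close> with
\<open>s = (l - \<beta>) - (k - \<alpha>)\<close>.

The theorem therefore reduces to one estimate (\<open>growth_hmult_powr\<close>): if
\<open>\<bar>h z\<bar> \<le> A (1 - \<bar>z\<bar>\<^sup>2) powr (-a)\<close> in the ball, with \<open>a > 0\<close> and \<open>a + s > 0\<close>, then the
function with homogeneous parts \<open>j powr s * h\<^sub>j\<close> is bounded by \<open>C A (1 - \<bar>z\<bar>\<^sup>2) powr (-(a + s))\<close>,
with \<open>C\<close> depending on \<open>a\<close> and \<open>s\<close> only. Write \<open>s = N - \<sigma>\<close> with \<open>N\<close> a natural number and
\<open>\<sigma> > 0\<close>. The power \<open>j\<^sup>N\<close> is \<open>N\<close> radial derivatives, each of which costs one power of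
\<open>1 - \<bar>z\<bar>\<^sup>2\<close> by Cauchy's inequality (\<open>growth_radial_deriv\<close>). The power \<open>j powr (-\<sigma>)\<close> is a
fractional integration, because \<open>\<Gamma>(\<sigma>) j powr (-\<sigma>) = \<integral> t powr (\<sigma> - 1) exp (-j t) dt\<close> over the
positive half-line; hence the new function at \<open>z\<close> is \<open>1 / \<Gamma>(\<sigma>)\<close> times the integral of
\<open>t powr (\<sigma> - 1) (h (exp (-t) z) - h 0)\<close>, and it gains \<open>\<sigma>\<close> powers (\<open>growth_hmult_negative\<close>).

With \<open>\<alpha> = \<beta>\<close> the estimate shows that membership in the Lipschitz space does not depend on the
order \<open>k\<close>; in general it gives boundedness of the operator. Interchanging \<open>\<alpha>\<close> and \<open>\<beta>\<close> gives
the inverse, since \<open>j powr (\<beta> - \<alpha>) * j powr (\<alpha> - \<beta>) = 1\<close>.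

Two foundations have to be laid first. A function that is complex differentiable in the ball has a
unique absolutely convergent expansion over multi-indices (\<open>taylor_has_sum\<close>,
\<open>taylor_coeffs_eqI\<close>); this is proved on polydiscs, one variable at a time. Conversely, multiplying
the homogeneous parts by a sequence of subexponential growth produces again a holomorphic
function, whose homogeneous parts are the expected ones (\<open>holo_on_hmult\<close>, \<open>hpart_hmult\<close>).\<close>

section \<open>Coefficients of power series in one variable\<close>

lemma powser_coeffs_unique:
  fixes c d :: "nat \<Rightarrow> complex"
  assumes "r > 0"
    and c: "\<And>w. norm w < r \<Longrightarrow> (\<lambda>j. c j * w ^ j) sums f w"
    and d: "\<And>w. norm w < r \<Longrightarrow> (\<lambda>j. d j * w ^ j) sums f w"
  shows "c = d"
proof
  fix m
  define a where "a j = c j - d j" for j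
  have a: "(\<lambda>j. a j * w ^ j) sums 0" if "norm w < r" for w
    using sums_diff[OF c[OF that] d[OF that]] by (simp add: a_def algebra_simps)
  have "a m = 0"
  proof (cases "m = 0")
    case True
    then show ?thesis using a[of 0] \<open>r > 0\<close> by simp
  next
    case False
    show ?thesis
    proof (rule ccontr)
      assume "a m \<noteq> 0"
      have sums: "\<And>w. norm (w - 0) < r \<Longrightarrow> (\<lambda>j. a j * (w - 0) ^ j) sums 0"
        using a by simp
      show False
      proof (rule powser_0_nonzero[OF \<open>r > 0\<close> sums refl \<open>a m \<noteq> 0\<close>])
        show "m > 0" using False by simp
        fix s :: real
        assume "s > 0" and nz: "\<And>z. z \<in> cball (0::complex) s - {0} \<Longrightarrow> (0::complex) \<noteq> 0"
        then show False using nz[of "of_real s"] by simp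
      qed
    qed
  qed
  then show "c m = d m" by (simp add: a_def)
qed

lemma Cauchy_coeff_bound_open:
  assumes hol: "f holomorphic_on ball 0 r" and "r > 0"
    and M: "\<And>w. norm w < r \<Longrightarrow> norm (f w) \<le> M"
  shows "norm ((deriv ^^ n) f 0 / fact n) \<le> M / r ^ n"
proof -
  have le: "norm ((deriv ^^ n) f 0 / fact n) * s ^ n \<le> M" if "0 < s" "s < r" for s
  proof -
    have "norm ((deriv ^^ n) f 0) \<le> fact n * M / s ^ n"
    proof (rule Cauchy_inequality)
      show "f holomorphic_on ball 0 s" using hol that by (auto intro: holomorphic_on_subset)
      have "f holomorphic_on cball 0 s" using hol that by (auto intro: holomorphic_on_subset)
      then show "continuous_on (cball 0 s) f" by (rule holomorphic_on_imp_continuous_on)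
    qed (use that M in auto)
    then show ?thesis using that by (simp add: norm_divide field_simps)
  qed
  \<comment> \<open>Cauchy's inequality requires continuity on the closed disc, hence the passage to the limit from smaller radii.\<close>
  have "((\<lambda>s. norm ((deriv ^^ n) f 0 / fact n) * s ^ n) \<longlongrightarrow>
          norm ((deriv ^^ n) f 0 / fact n) * r ^ n) (at_left r)"
    by (intro tendsto_intros)
  moreover have "\<forall>\<^sub>F s in at_left r. norm ((deriv ^^ n) f 0 / fact n) * s ^ n \<le> M"
    using eventually_at_left_real[OF \<open>r > 0\<close>] by eventually_elim (use le in auto)
  ultimately have "norm ((deriv ^^ n) f 0 / fact n) * r ^ n \<le> M"
    by (intro tendsto_upperbound) auto
  then show ?thesis using \<open>r > 0\<close> by (simp add: field_simps)
qed

lemma powser_coeff_bound: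
  fixes c :: "nat \<Rightarrow> complex"
  assumes "r > 0"
    and c: "\<And>w. norm w < r \<Longrightarrow> (\<lambda>j. c j * w ^ j) sums f w"
    and M: "\<And>w. norm w < r \<Longrightarrow> norm (f w) \<le> M"
  shows "norm (c n) \<le> M / r ^ n"
proof -
  have hol: "f holomorphic_on ball 0 r"
    by (rule power_series_holomorphic[where a = c]) (use c in auto)
  have "c = (\<lambda>j. (deriv ^^ j) f 0 / fact j)"
    by (rule powser_coeffs_unique[OF \<open>r > 0\<close> c])
       (use holomorphic_power_series[OF hol] in auto)
  then show ?thesis using Cauchy_coeff_bound_open[OF hol \<open>r > 0\<close> M] by simp
qed

section \<open>Power series expansion on polydiscs\<close>

definition polydisc :: "('n \<Rightarrow> real) \<Rightarrow> ('n \<Rightarrow> complex) set" where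
  "polydisc r = {x. \<forall>i. norm (x i) < r i}"

text \<open>Separate holomorphy together with a bound is the notion that passes to the coefficients of an
expansion in one of the variables. Points are plain functions here, so that one coordinate can be updated.\<close>

definition bounded_sep_holo :: "('n \<Rightarrow> real) \<Rightarrow> real \<Rightarrow> (('n \<Rightarrow> complex) \<Rightarrow> complex) \<Rightarrow> bool" where
  "bounded_sep_holo r M g \<longleftrightarrow>
     (\<forall>x\<in>polydisc r. norm (g x) \<le> M \<and> (\<forall>k. (\<lambda>w. g (x(k := w))) holomorphic_on ball 0 (r k)))"

definition slice_coeff :: "'n \<Rightarrow> nat \<Rightarrow> (('n \<Rightarrow> complex) \<Rightarrow> complex) \<Rightarrow> ('n \<Rightarrow> complex) \<Rightarrow> complex" where
  "slice_coeff k j g x = (deriv ^^ j) (\<lambda>w. g (x(k := w))) 0 / fact j"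

lemma polydisc_upd [simp]: "x \<in> polydisc r \<Longrightarrow> norm w < r k \<Longrightarrow> x(k := w) \<in> polydisc r"
  by (auto simp: polydisc_def)

lemma slice_coeff_upd_same [simp]: "slice_coeff k j g (x(k := w)) = slice_coeff k j g x"
  by (simp add: slice_coeff_def)

lemma slice_expansion:
  assumes g: "bounded_sep_holo r M g" and x: "x \<in> polydisc r" and w: "norm w < r k"
  shows "(\<lambda>j. slice_coeff k j g x * w ^ j) sums g (x(k := w))"
  using holomorphic_power_series[of "\<lambda>w. g (x(k := w))" 0 "r k" w] g x w
  by (auto simp: bounded_sep_holo_def slice_coeff_def)

lemma slice_coeff_bound:
  assumes g: "bounded_sep_holo r M g" and x: "x \<in> polydisc r" and r: "r k > 0"
  shows "norm (slice_coeff k j g x) \<le> M / r k ^ j"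
  unfolding slice_coeff_def
  by (rule Cauchy_coeff_bound_open) (use assms in \<open>auto simp: bounded_sep_holo_def\<close>)

text \<open>The coefficient \<open>c\<^sub>j\<close> of \<open>w\<^sup>j\<close> in the \<open>k\<close>-th variable is the limit, as \<open>w\<close> tends to \<open>0\<close>, of the
remainder of order \<open>j\<close> divided by \<open>w\<^sup>j\<close>. For fixed \<open>w\<close> this quotient is holomorphic in every other
variable once the earlier coefficients are, and the Cauchy bounds make the limit uniform.\<close>

lemma bounded_sep_holo_slice_coeff:
  fixes g :: "('n \<Rightarrow> complex) \<Rightarrow> complex"
  assumes g: "bounded_sep_holo r M g" and r: "\<And>i. r i > 0"
  shows "bounded_sep_holo r (M / r k ^ j) (slice_coeff k j g)"
proof (induction j rule: less_induct)
  case (less j)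
  have "(\<lambda>v. slice_coeff k j g (x(i := v))) holomorphic_on ball 0 (r i)"
    if x: "x \<in> polydisc r" for x i
  proof (cases "i = k")
    case True
    then show ?thesis by simp
  next
    case False
    define c where "c p v = slice_coeff k p g (x(i := v))" for p v
    \<comment> \<open>A null sequence inside the disc of radius r k; the offset 2 keeps the geometric ratio q below 1 also for n = 0.\<close>
    define w where "w n = complex_of_real (r k / (real n + 2))" for n
    define F where "F n v = (g (x(i := v, k := w n)) - (\<Sum>p<j. c p v * w n ^ p)) / w n ^ j" for n v
    have nw: "norm (w n) = r k / (real n + 2)" for n
      using r[of k] unfolding w_def norm_of_real by simp
    have wk: "norm (w n) < r k" "w n \<noteq> 0" for n
    proof -
      show "norm (w n) < r k" using r[of k] by (simp add: nw field_simps add_pos_nonneg)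
      have "norm (w n) > 0" using r[of k] by (simp add: nw)
      then show "w n \<noteq> 0" by auto
    qed
    have M0: "M \<ge> 0"
    proof -
      have "norm (g x) \<le> M" using g x by (auto simp: bounded_sep_holo_def)
      then show ?thesis using norm_ge_zero order_trans by blast
    qed
    have hol: "F n holomorphic_on ball 0 (r i)" for n
    proof -
      have "(\<lambda>v. g ((x(k := w n))(i := v))) holomorphic_on ball 0 (r i)"
        using g polydisc_upd[OF x wk(1)] unfolding bounded_sep_holo_def by blast
      moreover have "(\<lambda>v. c p v) holomorphic_on ball 0 (r i)" if "p < j" for p
        using less.IH[OF that] x unfolding bounded_sep_holo_def c_def by blast
      ultimately show ?thesis unfolding F_def using wk(2)[of n] False
        by (intro holomorphic_intros) (auto simp: fun_upd_twist)
    qed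
    have est: "norm (F n v - c j v) \<le> (M / r k ^ j) * (1 / (real n + 1))" if v: "norm v < r i" for n v
    proof -
      have xv: "x(i := v) \<in> polydisc r" using x v by simp
      have "(\<lambda>p. c p v * w n ^ p) sums g (x(i := v, k := w n))"
        unfolding c_def by (rule slice_expansion[OF g xv wk(1)])
      then have "(\<lambda>p. c (p + Suc j) v * w n ^ (p + Suc j)) sums
          (g (x(i := v, k := w n)) - (\<Sum>p<Suc j. c p v * w n ^ p))"
        by (rule sums_split_initial_segment)
      then have "(\<lambda>p. c (p + Suc j) v * w n ^ (p + Suc j) / w n ^ j) sums
          ((g (x(i := v, k := w n)) - (\<Sum>p<Suc j. c p v * w n ^ p)) / w n ^ j)"
        by (rule sums_divide)
      moreover have "(g (x(i := v, k := w n)) - (\<Sum>p<Suc j. c p v * w n ^ p)) / w n ^ j = F n v - c j v"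
        using wk(2)[of n] by (simp add: F_def field_simps)
      moreover have "c (p + Suc j) v * w n ^ (p + Suc j) / w n ^ j = c (p + Suc j) v * w n ^ Suc p" for p
        using wk(2)[of n] by (simp add: power_add)
      ultimately have S: "(\<lambda>p. c (p + Suc j) v * w n ^ Suc p) sums (F n v - c j v)" by simp
      define q where "q = 1 / (real n + 2)"
      have q: "0 < q" "q < 1" and nwq: "norm (w n) = q * r k"
        by (auto simp: q_def nw)
      have B: "norm (c (p + Suc j) v * w n ^ Suc p) \<le> (M / r k ^ j) * q ^ Suc p" for p
      proof -
        have "norm (c (p + Suc j) v) \<le> M / r k ^ (p + Suc j)"
          unfolding c_def by (rule slice_coeff_bound[OF g xv r])
        then have "norm (c (p + Suc j) v) * norm (w n) ^ Suc p \<le> M / r k ^ (p + Suc j) * norm (w n) ^ Suc p"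
          by (intro mult_right_mono) auto
        also have "\<dots> = (M / r k ^ j) * q ^ Suc p"
          using r[of k] by (simp add: nwq power_add power_mult_distrib)
        finally show ?thesis by (simp add: norm_mult norm_power)
      qed
      have "(\<lambda>p. q ^ Suc p) sums (q * (1 / (1 - q)))"
        using sums_mult[OF geometric_sums[of q], of q] q by simp
      then have G: "(\<lambda>p. (M / r k ^ j) * q ^ Suc p) sums ((M / r k ^ j) * (q * (1 / (1 - q))))"
        by (rule sums_mult)
      have "norm (F n v - c j v) \<le> (M / r k ^ j) * (q * (1 / (1 - q)))"
        using norm_suminf_le[OF B sums_summable[OF G]] sums_unique[OF S] sums_unique[OF G] by simp
      also have "q * (1 / (1 - q)) = 1 / (real n + 1)"
        by (simp add: q_def field_simps)
      finally show ?thesis .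
    qed
    have lim: "uniform_limit (ball 0 (r i)) F (c j) sequentially"
    proof (rule uniform_limitI)
      fix e :: real assume "e > 0"
      have "(\<lambda>n. (M / r k ^ j) * (1 / (real n + 1))) \<longlonglongrightarrow> (M / r k ^ j) * 0"
        by (intro tendsto_intros) real_asymp
      then have "\<forall>\<^sub>F n in sequentially. (M / r k ^ j) * (1 / (real n + 1)) < e"
        using \<open>e > 0\<close> by (simp add: order_tendsto_iff)
      then show "\<forall>\<^sub>F n in sequentially. \<forall>v\<in>ball 0 (r i). dist (F n v) (c j v) < e"
        by eventually_elim (auto simp: dist_norm intro: le_less_trans[OF est])
    qed
    have "c j holomorphic_on ball 0 (r i)"
    proof (rule holomorphic_uniform_sequence[OF open_ball hol])
      fix v :: complex assume "v \<in> ball 0 (r i)"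
      then obtain d where "d > 0" "cball v d \<subseteq> ball 0 (r i)"
        using open_contains_cball_eq[OF open_ball] by blast
      then show "\<exists>d>0. cball v d \<subseteq> ball 0 (r i) \<and> uniform_limit (cball v d) F (c j) sequentially"
        using uniform_limit_on_subset[OF lim] by blast
    qed
    then show ?thesis by (simp add: c_def[abs_def])
  qed
  then show ?case
    using slice_coeff_bound[OF g _ r] by (auto simp: bounded_sep_holo_def)
qed


text \<open>The exponents of monomials in the variables from \<open>A\<close>. An expansion in the variables \<open>insert k A\<close>
is an expansion in the variable \<open>k\<close> whose coefficients are expansions in \<open>A\<close>, which is the induction
step for existence and uniqueness below.\<close>

definition supp_in :: "'n set \<Rightarrow> ('n \<Rightarrow> nat) set" where
  "supp_in A = {m. \<forall>i. i \<notin> A \<longrightarrow> m i = 0}"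

lemma supp_in_UNIV [simp]: "supp_in UNIV = UNIV"
  by (simp add: supp_in_def)

lemma has_sum_supp_in_insert:
  assumes "k \<notin> A"
  shows "(f has_sum s) (supp_in (insert k A)) \<longleftrightarrow>
         ((\<lambda>(j, m). f (m(k := j))) has_sum s) (UNIV \<times> supp_in A)"
proof -
  have "bij_betw (\<lambda>(j, m). m(k := j)) (UNIV \<times> supp_in A) (supp_in (insert k A))"
    by (rule bij_betw_byWitness[where f' = "\<lambda>m. (m k, m(k := 0))"])
       (use assms in \<open>auto simp: supp_in_def fun_eq_iff\<close>)
  from has_sum_reindex_bij_betw[OF this, of f s] show ?thesis
    by (simp add: case_prod_unfold)
qed

lemma monomial_insert:
  fixes x :: "'n \<Rightarrow> 'a::comm_monoid_mult"
  assumes "finite A" "k \<notin> A"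
  shows "(\<Prod>i\<in>insert k A. x i ^ (m(k := j)) i) = (\<Prod>i\<in>A. x i ^ m i) * x k ^ j"
proof -
  have "(\<Prod>i\<in>A. x i ^ (m(k := j)) i) = (\<Prod>i\<in>A. x i ^ m i)"
    using assms by (intro prod.cong) auto
  then show ?thesis using assms by (simp add: mult.commute)
qed

lemma summable_on_monomials:
  fixes q :: "'n \<Rightarrow> real"
  assumes "finite A" "\<And>i. i \<in> A \<Longrightarrow> 0 \<le> q i \<and> q i < 1"
  shows "(\<lambda>m. \<Prod>i\<in>A. q i ^ m i) summable_on supp_in A"
  using assms
proof (induction A rule: finite_induct)
  case empty
  have "supp_in {} = {\<lambda>_::'n. 0::nat}" by (auto simp: supp_in_def)
  then show ?case by simp
next
  case (insert k A)
  let ?P = "\<lambda>m. \<Prod>i\<in>A. q i ^ m i"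
  have "(\<lambda>(j, m). ?P m * q k ^ j) summable_on (UNIV \<times> supp_in A)"
  proof (rule summable_on_SigmaI)
    fix j :: nat
    show "((\<lambda>m. case (j, m) of (j, m) \<Rightarrow> ?P m * q k ^ j) has_sum (infsum ?P (supp_in A) * q k ^ j)) (supp_in A)"
      using insert by (auto intro!: has_sum_cmult_left)
  next
    have "summable (\<lambda>j. infsum ?P (supp_in A) * q k ^ j)"
      using insert.prems[of k] by (intro summable_mult summable_geometric) auto
    moreover have "infsum ?P (supp_in A) \<ge> 0"
      using insert by (intro infsum_nonneg prod_nonneg) auto
    ultimately show "(\<lambda>j. infsum ?P (supp_in A) * q k ^ j) summable_on UNIV"
      using insert.prems[of k] by (subst summable_on_UNIV_nonneg_real_iff) auto
  qed (use insert in \<open>auto intro!: mult_nonneg_nonneg prod_nonneg\<close>)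
  then obtain s where "((\<lambda>(j, m). ?P m * q k ^ j) has_sum s) (UNIV \<times> supp_in A)"
    by (auto simp: summable_on_def)
  then have "((\<lambda>m. \<Prod>i\<in>insert k A. q i ^ m i) has_sum s) (supp_in (insert k A))"
    unfolding has_sum_supp_in_insert[OF insert.hyps(2)] monomial_insert[OF insert.hyps] .
  then show ?case by (auto simp: summable_on_def)
qed

text \<open>Induction on the set of variables on which \<open>g\<close> depends: the coefficients of \<open>g\<close> in the new variable
depend on the old variables only and are expanded by the induction hypothesis. The Cauchy bounds are
carried along because they dominate the whole family by a product of geometric series, which gives
the absolute convergence that allows summing in the order of the expansion in one variable.\<close>

lemma multi_power_series_exists:
  fixes g :: "('n \<Rightarrow> complex) \<Rightarrow> complex"
  assumes "finite A" and r: "\<And>i. r i > 0"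
    and "bounded_sep_holo r M g"
    and "\<And>x y. (\<forall>i\<in>A. x i = y i) \<Longrightarrow> g x = g y"
  shows "\<exists>a. (\<forall>m. norm (a m) \<le> M / (\<Prod>i\<in>A. r i ^ m i)) \<and>
             (\<forall>x\<in>polydisc r. ((\<lambda>m. a m * (\<Prod>i\<in>A. x i ^ m i)) has_sum g x) (supp_in A))"
  using assms(1,3,4)
proof (induction A arbitrary: M g rule: finite_induct)
  case empty
  have 0: "(\<lambda>_. 0) \<in> polydisc r" using r by (simp add: polydisc_def)
  have S: "supp_in {} = {\<lambda>_::'n. 0::nat}" by (auto simp: supp_in_def)
  have "((\<lambda>m. g (\<lambda>_. 0)) has_sum g x) {\<lambda>_::'n. 0::nat}" for x
    using empty.prems(2)[of x "\<lambda>_. 0"] has_sum_finite[of "{\<lambda>_::'n. 0::nat}" "\<lambda>m. g (\<lambda>_. 0)"]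
    by simp
  then show ?case using empty.prems(1) 0
    by (intro exI[of _ "\<lambda>_. g (\<lambda>_. 0)"]) (auto simp: S bounded_sep_holo_def)
next
  case (insert k A)
  let ?c = "\<lambda>j. slice_coeff k j g"
  have dep: "?c j x = ?c j y" if "\<forall>i\<in>A. x i = y i" for j x y
  proof -
    have "(\<lambda>w. g (x(k := w))) = (\<lambda>w. g (y(k := w)))"
      using that by (intro ext insert.prems(2)) auto
    then show ?thesis by (simp add: slice_coeff_def)
  qed
  have "\<exists>a. (\<forall>m. norm (a m) \<le> (M / r k ^ j) / (\<Prod>i\<in>A. r i ^ m i)) \<and>
             (\<forall>x\<in>polydisc r. ((\<lambda>m. a m * (\<Prod>i\<in>A. x i ^ m i)) has_sum ?c j x) (supp_in A))" for j
    by (rule insert.IH[OF bounded_sep_holo_slice_coeff[OF insert.prems(1) r] dep])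
  then have "\<forall>j. \<exists>a. (\<forall>m. norm (a m) \<le> (M / r k ^ j) / (\<Prod>i\<in>A. r i ^ m i)) \<and>
             (\<forall>x\<in>polydisc r. ((\<lambda>m. a m * (\<Prod>i\<in>A. x i ^ m i)) has_sum ?c j x) (supp_in A))"
    by (rule allI)
  from choice[OF this] obtain a where a: "\<And>j m. norm (a j m) \<le> (M / r k ^ j) / (\<Prod>i\<in>A. r i ^ m i)"
    "\<And>j x. x \<in> polydisc r \<Longrightarrow> ((\<lambda>m. a j m * (\<Prod>i\<in>A. x i ^ m i)) has_sum ?c j x) (supp_in A)"
    by auto
  define b where "b m = a (m k) (m(k := 0))" for m
  have bound: "norm (b m) \<le> M / (\<Prod>i\<in>insert k A. r i ^ m i)" for m
  proof -
    have "(\<Prod>i\<in>insert k A. r i ^ m i) = (\<Prod>i\<in>A. r i ^ (m(k := 0)) i) * r k ^ m k"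
      using monomial_insert[OF insert.hyps, of r "m(k := 0)" "m k"] by simp
    then show ?thesis
      using a(1)[of "m k" "m(k := 0)"] unfolding b_def by (simp add: mult.commute)
  qed
  have sum: "((\<lambda>m. b m * (\<Prod>i\<in>insert k A. x i ^ m i)) has_sum g x) (supp_in (insert k A))"
    if x: "x \<in> polydisc r" for x
  proof -
    have xk: "norm (x k) < r k" using x by (simp add: polydisc_def)
    have "(\<lambda>m. M * (\<Prod>i\<in>insert k A. (norm (x i) / r i) ^ m i)) summable_on supp_in (insert k A)"
      using x r insert.hyps
      by (intro summable_on_cmult_right summable_on_monomials)
         (auto simp: polydisc_def less_imp_le)
    moreover have "norm (b m * (\<Prod>i\<in>insert k A. x i ^ m i)) \<le>
        M * (\<Prod>i\<in>insert k A. (norm (x i) / r i) ^ m i)" for m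
    proof -
      have "norm (b m * (\<Prod>i\<in>insert k A. x i ^ m i)) = norm (b m) * (\<Prod>i\<in>insert k A. norm (x i) ^ m i)"
        by (simp add: norm_mult norm_power flip: prod_norm)
      also have "\<dots> \<le> M / (\<Prod>i\<in>insert k A. r i ^ m i) * (\<Prod>i\<in>insert k A. norm (x i) ^ m i)"
        by (intro mult_right_mono bound prod_nonneg) auto
      also have "\<dots> = M * (\<Prod>i\<in>insert k A. (norm (x i) / r i) ^ m i)"
        by (simp add: power_divide prod_dividef)
      finally show ?thesis .
    qed
    ultimately have "(\<lambda>m. b m * (\<Prod>i\<in>insert k A. x i ^ m i)) summable_on supp_in (insert k A)"
      by (rule abs_summable_summable[OF summable_on_comparison_test]) simp_all
    then obtain s where s: "((\<lambda>m. b m * (\<Prod>i\<in>insert k A. x i ^ m i)) has_sum s) (supp_in (insert k A))"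
      by (auto simp: summable_on_def)
    have "((\<lambda>(j, m). b (m(k := j)) * ((\<Prod>i\<in>A. x i ^ m i) * x k ^ j)) has_sum s) (UNIV \<times> supp_in A)"
      using s unfolding has_sum_supp_in_insert[OF insert.hyps(2)] monomial_insert[OF insert.hyps] .
    moreover have "((\<lambda>m. case (j, m) of (j, m) \<Rightarrow> b (m(k := j)) * ((\<Prod>i\<in>A. x i ^ m i) * x k ^ j))
        has_sum (?c j x * x k ^ j)) (supp_in A)" for j
    proof -
      have "((\<lambda>m. a j m * (\<Prod>i\<in>A. x i ^ m i) * x k ^ j) has_sum (?c j x * x k ^ j)) (supp_in A)"
        by (intro has_sum_cmult_left a(2) x)
      moreover have "m(k := 0) = m" if "m \<in> supp_in A" for m
        using that insert.hyps(2) by (auto simp: supp_in_def)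
      ultimately show ?thesis
        by (subst has_sum_cong[where g = "\<lambda>m. a j m * (\<Prod>i\<in>A. x i ^ m i) * x k ^ j"])
           (auto simp: b_def)
    qed
    \<comment> \<open>Summing first over the old variables leaves the expansion in the new variable, whose sum is known.\<close>
    ultimately have "((\<lambda>j. ?c j x * x k ^ j) has_sum s) UNIV"
      by (rule has_sum_SigmaD)
    then have "s = g (x(k := x k))"
      using has_sum_imp_sums slice_expansion[OF insert.prems(1) x xk] sums_unique2 by blast
    then show ?thesis using s by simp
  qed
  show ?case using bound sum by blast
qed

lemma multi_power_series_zero:
  fixes c :: "('n \<Rightarrow> nat) \<Rightarrow> complex"
  assumes "finite A" and r: "\<And>i. r i > 0"
    and "\<And>x. x \<in> polydisc r \<Longrightarrow> ((\<lambda>m. c m * (\<Prod>i\<in>A. x i ^ m i)) has_sum 0) (supp_in A)"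
    and "m \<in> supp_in A"
  shows "c m = 0"
  using assms(1,3,4)
proof (induction A arbitrary: c m rule: finite_induct)
  case empty
  have S: "supp_in {} = {\<lambda>_::'n. 0::nat}" by (auto simp: supp_in_def)
  have "(\<lambda>_. 0) \<in> polydisc r" using r by (simp add: polydisc_def)
  from empty.prems(1)[OF this] have "(c has_sum 0) {\<lambda>_. 0}" by (simp add: S)
  moreover have "(c has_sum sum c {\<lambda>_. 0}) {\<lambda>_. 0}" by (rule has_sum_finite) simp
  ultimately have "sum c {\<lambda>_. 0} = 0" by (metis has_sum_unique)
  then show ?case using empty.prems(2) S by simp
next
  case (insert k A)
  have E: "((\<lambda>(j, m). c (m(k := j)) * ((\<Prod>i\<in>A. x i ^ m i) * w ^ j)) has_sum 0) (UNIV \<times> supp_in A)"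
    if x: "x \<in> polydisc r" and w: "norm w < r k" for x w
  proof -
    have "((\<lambda>(j, m). c (m(k := j)) * ((\<Prod>i\<in>A. (x(k := w)) i ^ m i) * (x(k := w)) k ^ j)) has_sum 0) (UNIV \<times> supp_in A)"
      using insert.prems(1)[OF polydisc_upd[OF x w]]
      unfolding has_sum_supp_in_insert[OF insert.hyps(2)] monomial_insert[OF insert.hyps] .
    moreover have "(\<Prod>i\<in>A. (x(k := w)) i ^ m i) = (\<Prod>i\<in>A. x i ^ m i)" for m
      using insert.hyps by (intro prod.cong) auto
    ultimately show ?thesis by simp
  qed
  have "((\<lambda>m. c (m(k := j)) * (\<Prod>i\<in>A. x i ^ m i)) has_sum 0) (supp_in A)"
    if x: "x \<in> polydisc r" for x j
  proof -
    \<comment> \<open>Any nonzero value of the k-th variable shows that the inner sums converge.\<close>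
    define w where "w = complex_of_real (r k / 2)"
    have w: "w \<noteq> 0" "norm w < r k" using r[of k] unfolding w_def norm_of_real by auto
    have sm: "(\<lambda>m. c (m(k := j)) * (\<Prod>i\<in>A. x i ^ m i)) summable_on supp_in A" for j
    proof -
      have "(\<lambda>m. c (m(k := j)) * ((\<Prod>i\<in>A. x i ^ m i) * w ^ j)) summable_on supp_in A"
        by (rule summable_on_SigmaD1[of "\<lambda>j m. c (m(k := j)) * ((\<Prod>i\<in>A. x i ^ m i) * w ^ j)" UNIV])
           (use E[OF x w(2)] in \<open>auto simp: summable_on_def\<close>)
      then have "(\<lambda>m. c (m(k := j)) * ((\<Prod>i\<in>A. x i ^ m i) * w ^ j) * (1 / w ^ j)) summable_on supp_in A"
        by (rule summable_on_cmult_left)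
      moreover have "c (m(k := j)) * ((\<Prod>i\<in>A. x i ^ m i) * w ^ j) * (1 / w ^ j) =
          c (m(k := j)) * (\<Prod>i\<in>A. x i ^ m i)" for m
        using w(1) by simp
      ultimately show ?thesis by simp
    qed
    define s where "s j = infsum (\<lambda>m. c (m(k := j)) * (\<Prod>i\<in>A. x i ^ m i)) (supp_in A)" for j
    have "(\<lambda>j. s j * v ^ j) sums 0" if v: "norm v < r k" for v
    proof (rule has_sum_imp_sums, rule has_sum_SigmaD[OF E[OF x v]])
      fix j
      show "((\<lambda>m. case (j, m) of (j, m) \<Rightarrow> c (m(k := j)) * ((\<Prod>i\<in>A. x i ^ m i) * v ^ j)) has_sum (s j * v ^ j)) (supp_in A)"
        using has_sum_cmult_left[OF has_sum_infsum[OF sm[of j]], of "v ^ j"]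
        by (simp add: s_def mult.assoc)
    qed
    then have "s = (\<lambda>_. 0)"
      by (intro powser_coeffs_unique[OF r[of k], of _ "\<lambda>_. 0"]) auto
    then show ?thesis using has_sum_infsum[OF sm[of j]] by (simp add: s_def fun_eq_iff)
  qed
  note zero = this
  have "m(k := 0) \<in> supp_in A" using insert.prems(2) by (simp add: supp_in_def)
  with zero have "c ((m(k := 0))(k := m k)) = 0" by (rule insert.IH[where c = "\<lambda>m'. c (m'(k := m k))"])
  then show ?case by simp
qed

section \<open>Taylor coefficients of holomorphic functions in the ball\<close>

lemma norm_smult_vec: "norm (c *s v) = norm c * norm v" for v :: "complex ^ 'n"
  by (simp add: norm_vec_def norm_mult L2_set_right_distrib)

lemma bounded_linear_smult_vec: "bounded_linear (\<lambda>w. w *s v)" for v :: "complex ^ 'n"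
proof -
  have "linear (\<lambda>w. w *s v)"
    by (rule linearI) (simp_all add: vec_eq_iff algebra_simps)
  then show ?thesis by (simp add: linear_conv_bounded_linear)
qed

lemma holo_on_line:
  fixes p v :: "complex ^ 'n"
  assumes D: "(f has_derivative D) (at (p + w *s v))" and lin: "\<And>c u. D (c *s u) = c * D u"
  shows "((\<lambda>w. f (p + w *s v)) has_field_derivative D v) (at w)"
proof -
  have "((\<lambda>w. p + w *s v) has_derivative (\<lambda>h. 0 + h *s v)) (at w)"
    by (intro has_derivative_add has_derivative_const
        bounded_linear_imp_has_derivative bounded_linear_smult_vec)
  from has_derivative_compose[OF this D] show ?thesis
    by (rule has_derivative_imp_has_field_derivative) (simp add: lin)
qed

lemma holo_on_imp_line_holomorphic:
  fixes p v :: "complex ^ 'n"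
  assumes "holo_on f S" "\<And>w. w \<in> U \<Longrightarrow> p + w *s v \<in> S"
  shows "(\<lambda>w. f (p + w *s v)) holomorphic_on U"
proof (rule holomorphic_onI)
  fix w assume "w \<in> U"
  then obtain D where "(f has_derivative D) (at (p + w *s v))" "\<And>c u. D (c *s u) = c * D u"
    using assms unfolding holo_on_def by blast
  from holo_on_line[OF this] show "(\<lambda>w. f (p + w *s v)) field_differentiable at w within U"
    by (meson field_differentiable_at_within field_differentiable_def)
qed

lemma holo_on_imp_continuous_on: "holo_on f S \<Longrightarrow> continuous_on S f"
  unfolding holo_on_def by (meson continuous_at_imp_continuous_on has_derivative_continuous)

lemma holo_on_bounded_cball:
  fixes f :: "complex ^ 'n \<Rightarrow> complex"
  assumes "holo_on f unit_ball" "\<rho> < 1"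
  obtains M where "M > 0" "\<And>z. norm z \<le> \<rho> \<Longrightarrow> norm (f z) \<le> M"
proof -
  have "continuous_on (cball 0 \<rho>) f"
    by (rule continuous_on_subset[OF holo_on_imp_continuous_on[OF assms(1)]]) (use assms(2) in auto)
  then have "bounded (f ` cball 0 \<rho>)"
    by (intro compact_imp_bounded compact_continuous_image) auto
  then obtain M where "M > 0" "\<forall>y\<in>f ` cball 0 \<rho>. norm y \<le> M" by (auto simp: bounded_pos)
  then show ?thesis by (intro that) auto
qed

lemma norm_vec_lambda_le:
  fixes x :: "'n::finite \<Rightarrow> complex"
  assumes "\<And>i. norm (x i) \<le> r i"
  shows "norm (\<chi> i. x i) \<le> sqrt (\<Sum>i\<in>UNIV. (r i)\<^sup>2)"
  unfolding norm_vec_def L2_set_def using assms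
  by (intro real_sqrt_le_mono sum_mono power_mono) auto

lemma holo_on_imp_bounded_sep_holo:
  fixes f :: "complex ^ 'n \<Rightarrow> complex"
  assumes f: "holo_on f unit_ball" and r: "\<And>i. r i > 0" "(\<Sum>i\<in>UNIV. (r i)\<^sup>2) < 1"
  shows "\<exists>M. bounded_sep_holo r M (\<lambda>x. f (\<chi> i. x i))"
proof -
  define \<rho> where "\<rho> = sqrt (\<Sum>i\<in>(UNIV::'n set). (r i)\<^sup>2)"
  have \<rho>: "\<rho> < 1" using r(2) by (simp add: \<rho>_def)
  have le: "norm (\<chi> i. x i) \<le> \<rho>" if "x \<in> polydisc r" for x
    unfolding \<rho>_def by (rule norm_vec_lambda_le) (use that in \<open>auto simp: polydisc_def less_imp_le\<close>)
  obtain M where M: "\<And>z. norm z \<le> \<rho> \<Longrightarrow> norm (f z) \<le> M"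
    by (rule holo_on_bounded_cball[OF f \<rho>]) (rule that)
  have "(\<lambda>w. f (\<chi> i. (x(k := w)) i)) holomorphic_on ball 0 (r k)" if x: "x \<in> polydisc r" for x k
  proof -
    define p where "p = (\<chi> i. (x(k := 0)) i)"
    have eq: "(\<chi> i. (x(k := w)) i) = p + w *s axis k 1" for w
      by (auto simp: vec_eq_iff axis_def p_def)
    have "p + w *s axis k 1 \<in> unit_ball" if "w \<in> ball 0 (r k)" for w
    proof -
      have "norm w < r k" using that by simp
      from le_less_trans[OF le[OF polydisc_upd[OF x this]] \<rho>]
      have "norm (p + w *s axis k 1) < 1" by (simp only: eq)
      then show ?thesis by simp
    qed
    then show ?thesis unfolding eq by (rule holo_on_imp_line_holomorphic[OF f])
  qed
  then have "bounded_sep_holo r M (\<lambda>x. f (\<chi> i. x i))"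
    unfolding bounded_sep_holo_def using M le by blast
  then show ?thesis by blast
qed

text \<open>Enlarging the squared modulus of each coordinate by the same small amount leaves room below \<open>1\<close>.\<close>

lemma polydisc_in_ball_exists:
  fixes z :: "complex ^ 'n"
  assumes "z \<in> unit_ball"
  shows "\<exists>r. (\<forall>i. r i > 0) \<and> (\<Sum>i\<in>UNIV. (r i)\<^sup>2) < 1 \<and> (\<lambda>i. z $ i) \<in> polydisc r"
proof -
  define e where "e = (1 - (norm z)\<^sup>2) / (2 * real CARD('n))"
  have "(norm z)\<^sup>2 < 1" using assms by (simp add: power_less_one_iff abs_square_less_1)
  then have e: "e > 0" by (simp add: e_def)
  have nz: "(norm z)\<^sup>2 = (\<Sum>i\<in>UNIV. (norm (z $ i))\<^sup>2)"
    unfolding norm_vec_def L2_set_def by (simp add: sum_nonneg)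
  define r where "r i = sqrt ((norm (z $ i))\<^sup>2 + e)" for i
  have "r i > 0" for i using e by (simp add: r_def add_nonneg_pos)
  moreover have "(\<Sum>i\<in>UNIV. (r i)\<^sup>2) = (norm z)\<^sup>2 + (1 - (norm z)\<^sup>2) / 2"
    using e by (simp add: r_def sum.distrib nz add_nonneg_pos less_imp_le add_nonneg_nonneg e_def)
  then have "(\<Sum>i\<in>UNIV. (r i)\<^sup>2) < 1" using \<open>(norm z)\<^sup>2 < 1\<close> by (simp add: field_simps)
  moreover have "norm (z $ i) < r i" for i
    unfolding r_def by (rule real_less_rsqrt) (use e in auto)
  ultimately show ?thesis by (intro exI[of _ r]) (simp add: polydisc_def)
qed

lemma power_series_unique_polydisc:
  fixes a b :: "('n::finite \<Rightarrow> nat) \<Rightarrow> complex"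
  assumes r: "\<And>i. r i > 0"
    and a: "\<And>z. (\<lambda>i. z $ i) \<in> polydisc r \<Longrightarrow> ((\<lambda>m. a m * mi_power z m) has_sum f z) UNIV"
    and b: "\<And>z. (\<lambda>i. z $ i) \<in> polydisc r \<Longrightarrow> ((\<lambda>m. b m * mi_power z m) has_sum f z) UNIV"
  shows "a = b"
proof
  fix m
  have "a m - b m = 0"
  proof (rule multi_power_series_zero[of UNIV r "\<lambda>m. a m - b m"])
    fix x assume "x \<in> polydisc r"
    then have "(\<lambda>i. (\<chi> i. x i) $ i) \<in> polydisc r" by simp
    from has_sum_add[OF a[OF this] has_sum_uminusI[OF b[OF this]]]
    show "((\<lambda>m. (a m - b m) * (\<Prod>i\<in>UNIV. x i ^ m i)) has_sum 0) (supp_in UNIV)"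
      by (simp add: mi_power_def algebra_simps)
  qed (use r in auto)
  then show "a m = b m" by simp
qed

text \<open>The ball is a union of polydiscs centred at \<open>0\<close>. The expansions on two of them have the same
coefficients, by uniqueness on their intersection, so the coefficients found on one small polydisc
serve for the whole ball.\<close>

lemma power_series_exists_ball:
  fixes f :: "complex ^ 'n \<Rightarrow> complex"
  assumes f: "holo_on f unit_ball"
  shows "\<exists>a. \<forall>z\<in>unit_ball. ((\<lambda>m. a m * mi_power z m) has_sum f z) UNIV"
proof -
  have ex: "\<exists>a. \<forall>z. (\<lambda>i. z $ i) \<in> polydisc r \<longrightarrow> ((\<lambda>m. a m * mi_power z m) has_sum f z) UNIV"
    if r: "\<And>i. r i > 0" "(\<Sum>i\<in>UNIV. (r i)\<^sup>2) < 1" for r :: "'n \<Rightarrow> real"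
  proof -
    obtain M where M: "bounded_sep_holo r M (\<lambda>x. f (\<chi> i. x i))"
      using holo_on_imp_bounded_sep_holo[OF f r] by blast
    have dep: "f (\<chi> i. x i) = f (\<chi> i. y i)" if "\<forall>i\<in>UNIV. x i = y i" for x y :: "'n \<Rightarrow> complex"
      using that by (simp add: vec_eq_iff)
    obtain a where a: "\<And>x. x \<in> polydisc r \<Longrightarrow> ((\<lambda>m. a m * (\<Prod>i\<in>UNIV. x i ^ m i)) has_sum f (\<chi> i. x i)) UNIV"
      using multi_power_series_exists[OF finite_class.finite_UNIV r(1) M dep] by auto
    have "((\<lambda>m. a m * mi_power z m) has_sum f z) UNIV" if "(\<lambda>i. z $ i) \<in> polydisc r" for z
      using a[OF that] by (simp add: mi_power_def)
    then show ?thesis by blast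
  qed
  obtain r0 :: "'n \<Rightarrow> real" where r0: "\<And>i. r0 i > 0" "(\<Sum>i\<in>UNIV. (r0 i)\<^sup>2) < 1"
    using polydisc_in_ball_exists[of "0 :: complex ^ 'n"] by auto
  obtain a where a: "\<And>z. (\<lambda>i. z $ i) \<in> polydisc r0 \<Longrightarrow> ((\<lambda>m. a m * mi_power z m) has_sum f z) UNIV"
    using ex[OF r0] by blast
  have "((\<lambda>m. a m * mi_power z m) has_sum f z) UNIV" if z: "z \<in> unit_ball" for z
  proof -
    obtain r where r: "\<And>i. r i > 0" "(\<Sum>i\<in>UNIV. (r i)\<^sup>2) < 1" "(\<lambda>i. z $ i) \<in> polydisc r"
      using polydisc_in_ball_exists[OF z] by blast
    obtain b where b: "\<And>z. (\<lambda>i. z $ i) \<in> polydisc r \<Longrightarrow> ((\<lambda>m. b m * mi_power z m) has_sum f z) UNIV"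
      using ex[OF r(1,2)] by blast
    have "a = b"
      by (rule power_series_unique_polydisc[of "\<lambda>i. min (r i) (r0 i)", OF _ a b])
         (use r r0 in \<open>auto simp: polydisc_def\<close>)
    then show ?thesis using b r(3) by blast
  qed
  then show ?thesis by blast
qed

lemma power_series_unique_unit_ball:
  fixes a b :: "('n::finite \<Rightarrow> nat) \<Rightarrow> complex"
  assumes a: "\<forall>z\<in>unit_ball. ((\<lambda>m. a m * mi_power z m) has_sum f z) UNIV"
    and b: "\<forall>z\<in>unit_ball. ((\<lambda>m. b m * mi_power z m) has_sum f z) UNIV"
  shows "a = b"
proof -
  obtain r :: "'n \<Rightarrow> real" where r: "\<And>i. r i > 0" "(\<Sum>i\<in>UNIV. (r i)\<^sup>2) < 1"
    using polydisc_in_ball_exists[of "0 :: complex ^ 'n"] by auto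
  have "z \<in> unit_ball" if "(\<lambda>i. z $ i) \<in> polydisc r" for z :: "complex ^ 'n"
  proof -
    have "norm (\<chi> i. z $ i) \<le> sqrt (\<Sum>i\<in>UNIV. (r i)\<^sup>2)"
      by (rule norm_vec_lambda_le) (use that in \<open>auto simp: polydisc_def less_imp_le\<close>)
    also have "\<dots> < 1" using r(2) by (intro real_less_lsqrt) (auto simp: sum_nonneg)
    finally have "norm z < 1" by simp
    then show ?thesis by simp
  qed
  then show ?thesis
    by (intro power_series_unique_polydisc[of r a f b] r(1)) (use a b in blast)+
qed

lemma taylor_coeffs_eqI:
  fixes a :: "('n::finite \<Rightarrow> nat) \<Rightarrow> complex"
  assumes "\<forall>z\<in>unit_ball. ((\<lambda>m. a m * mi_power z m) has_sum f z) UNIV"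
  shows "taylor_coeffs f = a"
  unfolding taylor_coeffs_def
proof (rule the_equality)
  show "\<forall>z\<in>unit_ball. ((\<lambda>m. a m * mi_power z m) has_sum f z) UNIV" by (rule assms)
qed (rule power_series_unique_unit_ball[OF _ assms])

lemma taylor_has_sum:
  fixes f :: "complex ^ 'n \<Rightarrow> complex"
  assumes "holo_on f unit_ball" "z \<in> unit_ball"
  shows "((\<lambda>m. taylor_coeffs f m * mi_power z m) has_sum f z) UNIV"
  using power_series_exists_ball[OF assms(1)] taylor_coeffs_eqI assms(2) by blast


section \<open>Series of holomorphic functions\<close>

lemma holo_on_cong:
  assumes "open S" "\<And>z. z \<in> S \<Longrightarrow> f z = g z" "holo_on f S"
  shows "holo_on g S"
  unfolding holo_on_def
proof
  fix z assume z: "z \<in> S"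
  then obtain D where D: "(f has_derivative D) (at z)" "\<forall>c v. D (c *s v) = c * D v"
    using assms(3) unfolding holo_on_def by blast
  have "(g has_derivative D) (at z)"
    by (rule has_derivative_transform_within_open[OF D(1) assms(1) z]) (rule assms(2))
  then show "\<exists>D. (g has_derivative D) (at z) \<and> (\<forall>c v. D (c *s v) = c * D v)"
    using D(2) by blast
qed

lemma holo_on_subset: "holo_on f S \<Longrightarrow> T \<subseteq> S \<Longrightarrow> holo_on f T"
  unfolding holo_on_def by blast

lemma holo_on_const: "holo_on (\<lambda>_. c) S"
  unfolding holo_on_def by (auto intro!: exI[of _ "\<lambda>_. 0"])

lemma holo_on_component: "holo_on (\<lambda>z. z $ k) S"
  unfolding holo_on_def
  by (auto intro!: exI[of _ "\<lambda>v. v $ k"] bounded_linear_imp_has_derivative bounded_linear_vec_nth)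

lemma holo_on_add:
  assumes "holo_on f S" "holo_on g S" shows "holo_on (\<lambda>z. f z + g z) S"
  unfolding holo_on_def
proof
  fix z assume "z \<in> S"
  then obtain D E where "(f has_derivative D) (at z)" "\<forall>c v. D (c *s v) = c * D v"
    "(g has_derivative E) (at z)" "\<forall>c v. E (c *s v) = c * E v"
    using assms unfolding holo_on_def by meson
  then show "\<exists>D. ((\<lambda>z. f z + g z) has_derivative D) (at z) \<and> (\<forall>c v. D (c *s v) = c * D v)"
    by (intro exI[of _ "\<lambda>v. D v + E v"]) (auto intro!: has_derivative_add simp: algebra_simps)
qed

lemma holo_on_mult:
  assumes "holo_on f S" "holo_on g S" shows "holo_on (\<lambda>z. f z * g z) S"
  unfolding holo_on_def
proof
  fix z assume "z \<in> S"
  then obtain D E where D: "(f has_derivative D) (at z)" "\<And>c v. D (c *s v) = c * D v"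
    and E: "(g has_derivative E) (at z)" "\<And>c v. E (c *s v) = c * E v"
    using assms unfolding holo_on_def by meson
  have "f z * E (c *s v) + D (c *s v) * g z = c * (f z * E v + D v * g z)" for c v
    by (simp add: D(2) E(2) algebra_simps)
  then show "\<exists>D. ((\<lambda>z. f z * g z) has_derivative D) (at z) \<and> (\<forall>c v. D (c *s v) = c * D v)"
    using has_derivative_mult[OF D(1) E(1)] by blast
qed

lemma holo_on_sum: "(\<And>i. i \<in> I \<Longrightarrow> holo_on (f i) S) \<Longrightarrow> holo_on (\<lambda>z. \<Sum>i\<in>I. f i z) S"
  by (induction I rule: infinite_finite_induct) (auto intro: holo_on_add holo_on_const)

lemma holo_on_prod: "(\<And>i. i \<in> I \<Longrightarrow> holo_on (f i) S) \<Longrightarrow> holo_on (\<lambda>z. \<Prod>i\<in>I. f i z) S"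
  by (induction I rule: infinite_finite_induct) (auto intro: holo_on_mult holo_on_const)

lemma holo_on_power: "holo_on f S \<Longrightarrow> holo_on (\<lambda>z. f z ^ n) S"
  by (induction n) (auto intro: holo_on_mult holo_on_const)

lemma holo_on_mi_power: "holo_on (\<lambda>z. mi_power z m) S"
  unfolding mi_power_def by (intro holo_on_prod holo_on_power holo_on_component)

text \<open>Cauchy's inequality for the restriction of \<open>F\<close> to the complex line through \<open>x\<close> in direction \<open>h\<close>.\<close>

lemma derivative_Cauchy_bound:
  fixes F :: "complex ^ 'n \<Rightarrow> complex"
  assumes F: "holo_on F (ball x r)" and "r > 0" and K: "\<And>y. y \<in> ball x r \<Longrightarrow> norm (F y) \<le> K"
    and D: "(F has_derivative D) (at x)" "\<And>c v. D (c *s v) = c * D v"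
  shows "norm (D h) \<le> K / r * norm h"
proof (cases "h = 0")
  case True
  then show ?thesis using has_derivative_bounded_linear[OF D(1)] by (simp add: linear_simps)
next
  case False
  define \<phi> where "\<phi> w = F (x + w *s h)" for w
  define s where "s = r / norm h"
  have s: "s > 0" using \<open>r > 0\<close> False by (simp add: s_def)
  have in_ball: "x + w *s h \<in> ball x r" if "norm w < s" for w
    using that False by (simp add: dist_norm norm_smult_vec s_def field_simps)
  have "(\<phi> has_field_derivative D h) (at 0)"
    unfolding \<phi>_def by (rule holo_on_line) (use D in auto)
  then have "deriv \<phi> 0 = D h" by (rule DERIV_imp_deriv)
  moreover have "norm ((deriv ^^ 1) \<phi> 0 / fact 1) \<le> K / s ^ 1"
  proof (rule Cauchy_coeff_bound_open[OF _ s])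
    show "\<phi> holomorphic_on ball 0 s"
      unfolding \<phi>_def by (rule holo_on_imp_line_holomorphic[OF F]) (rule in_ball, simp)
    show "norm (\<phi> w) \<le> K" if "norm w < s" for w
      unfolding \<phi>_def by (rule K[OF in_ball[OF that]])
  qed
  ultimately show ?thesis by (simp add: s_def)
qed

text \<open>Weierstrass' theorem: by Cauchy's inequality the majorant of the terms, on a ball of half the
radius, also majorizes their derivatives, so the series may be differentiated term by term.\<close>

lemma holo_on_series:
  fixes F :: "nat \<Rightarrow> complex ^ 'n \<Rightarrow> complex"
  assumes hol: "\<And>j. holo_on (F j) S"
    and dom: "\<And>z. z \<in> S \<Longrightarrow> \<exists>r>0. \<exists>K. ball z r \<subseteq> S \<and> summable K \<and> (\<forall>j. \<forall>x\<in>ball z r. norm (F j x) \<le> K j)"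
    and sums: "\<And>z. z \<in> S \<Longrightarrow> (\<lambda>j. F j z) sums f z"
  shows "holo_on f S"
  unfolding holo_on_def
proof
  fix z assume z: "z \<in> S"
  obtain r K where r: "r > 0" "ball z r \<subseteq> S" and K: "summable K" "\<And>j x. x \<in> ball z r \<Longrightarrow> norm (F j x) \<le> K j"
    using dom[OF z] by blast
  define B where "B = ball z (r / 2)"
  have BS: "ball x (r / 2) \<subseteq> ball z r" if "x \<in> B" for x
  proof
    fix y assume "y \<in> ball x (r / 2)"
    then show "y \<in> ball z r" using that dist_triangle[of z y x] by (simp add: B_def)
  qed
  have B: "B \<subseteq> ball z r" using r by (auto simp: B_def)
  have "\<forall>j. \<forall>x\<in>B. \<exists>D. (F j has_derivative D) (at x) \<and> (\<forall>c v. D (c *s v) = c * D v)"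
    using hol B r(2) unfolding holo_on_def by blast
  then obtain D where D: "\<And>j x. x \<in> B \<Longrightarrow> (F j has_derivative D j x) (at x)"
    "\<And>j x c v. x \<in> B \<Longrightarrow> D j x (c *s v) = c * D j x v"
    by metis
  have bound: "norm (D j x h) \<le> K j * (2 / r * norm h)" if x: "x \<in> B" for j x h
  proof -
    have "norm (D j x h) \<le> K j / (r / 2) * norm h"
    proof (rule derivative_Cauchy_bound[of "F j" x])
      show "holo_on (F j) (ball x (r / 2))" using holo_on_subset[OF hol] BS[OF x] r(2) by blast
      show "norm (F j y) \<le> K j" if "y \<in> ball x (r / 2)" for y using K(2) BS[OF x] that by blast
    qed (use D x r in auto)
    then show ?thesis by simp
  qed
  have sK: "summable (\<lambda>j. K j * (2 / r * norm h))" for h :: "complex ^ 'n"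
    by (rule summable_mult2[OF K(1)])
  have sD: "summable (\<lambda>j. D j x h)" if "x \<in> B" for x h
    by (rule summable_comparison_test'[OF sK, of 0]) (use bound[OF that] in auto)
  define G where "G x h = (\<Sum>j. D j x h)" for x h
  have tail: "\<forall>\<^sub>F n in sequentially. \<forall>x\<in>B. \<forall>h. norm ((\<Sum>j<n. D j x h) - G x h) \<le> e * norm h" if "e > 0" for e
  proof -
    have "e * r / 2 > 0" using that r by simp
    then obtain N where N: "\<And>n. n \<ge> N \<Longrightarrow> norm (\<Sum>j. K (j + n)) < e * r / 2"
      using suminf_exist_split[OF _ K(1)] by blast
    have "norm ((\<Sum>j<n. D j x h) - G x h) \<le> e * norm h" if n: "n \<ge> N" and x: "x \<in> B" for n x h
    proof -
      have "norm ((\<Sum>j<n. D j x h) - G x h) = norm (\<Sum>j. D (j + n) x h)"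
        using suminf_split_initial_segment[OF sD[OF x], of h n] by (simp add: G_def norm_minus_commute)
      also have "\<dots> \<le> (\<Sum>j. K (j + n) * (2 / r * norm h))"
        by (rule norm_suminf_le[OF bound[OF x]])
           (use summable_ignore_initial_segment[OF sK, of n] in auto)
      also have "\<dots> = (\<Sum>j. K (j + n)) * (2 / r * norm h)"
        by (rule suminf_mult2[OF summable_ignore_initial_segment[OF K(1), of n], symmetric])
      also have "\<dots> \<le> (e * r / 2) * (2 / r * norm h)"
        using N[OF n] r by (intro mult_right_mono) auto
      also have "\<dots> = e * norm h" using r by simp
      finally show ?thesis .
    qed
    then show ?thesis by (auto simp: eventually_sequentially)
  qed
  have zB: "z \<in> B" using r by (simp add: B_def)
  have "\<exists>g. \<forall>x\<in>B. (\<lambda>n. F n x) sums g x \<and> (g has_derivative G x) (at x within B)"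
  proof (rule has_derivative_series[where f' = D and x = z and l = "f z"])
    show "\<forall>\<^sub>F n in sequentially. \<forall>x\<in>B. \<forall>h. norm ((\<Sum>j<n. D j x h) - G x h) \<le> e * norm h" if "e > 0" for e
      by (rule tail[OF that])
    show "z \<in> B" "(\<lambda>n. F n z) sums f z" using zB sums[OF z] by auto
    show "convex B" by (simp add: B_def)
    show "(F n has_derivative D n x) (at x within B)" if "x \<in> B" for n x
      by (rule has_derivative_at_withinI[OF D(1)[OF that]])
  qed
  then obtain g where g: "\<And>x. x \<in> B \<Longrightarrow> (\<lambda>n. F n x) sums g x" "(g has_derivative G z) (at z within B)"
    using zB by blast
  have oB: "open B" by (simp add: B_def)
  have "(g has_derivative G z) (at z)" using g(2) at_within_open[OF zB oB] by simp
  moreover have "g x = f x" if "x \<in> B" for x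
    using sums_unique2[OF g(1)[OF that] sums] that B r(2) by blast
  ultimately have "(f has_derivative G z) (at z)"
    using has_derivative_transform_within_open[OF _ oB zB] by blast
  moreover have "G z (c *s v) = c * G z v" for c v
    unfolding G_def using suminf_mult[OF sD[OF zB], of c v] D(2)[OF zB] by simp
  ultimately show "\<exists>D. (f has_derivative D) (at z) \<and> (\<forall>c v. D (c *s v) = c * D v)" by blast
qed

section \<open>Homogeneous parts and multipliers\<close>

definition hpart :: "(complex ^ 'n \<Rightarrow> complex) \<Rightarrow> nat \<Rightarrow> complex ^ 'n \<Rightarrow> complex" where
  "hpart f j z = (\<Sum>m | mi_size m = j. taylor_coeffs f m * mi_power z m)"

lemma finite_mi_size: "finite {m :: 'n::finite \<Rightarrow> nat. mi_size m = j}"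
proof (rule finite_subset)
  show "{m :: 'n \<Rightarrow> nat. mi_size m = j} \<subseteq> PiE UNIV (\<lambda>_. {..j})"
    by (auto simp: mi_size_def intro: member_le_sum)
qed (auto intro: finite_PiE)

lemma mi_power_smult: "mi_power (c *s z) m = c ^ mi_size m * mi_power z m"
  by (simp add: mi_power_def mi_size_def power_mult_distrib prod.distrib power_sum)

lemma hpart_smult: "hpart f j (c *s z) = c ^ j * hpart f j z"
  unfolding hpart_def by (simp add: mi_power_smult sum_distrib_left algebra_simps)

lemma holo_on_hpart: "holo_on (hpart f j) S"
  unfolding hpart_def[abs_def] by (intro holo_on_sum holo_on_mult holo_on_const holo_on_mi_power)

lemma has_sum_by_degree:
  fixes F :: "('n::finite \<Rightarrow> nat) \<Rightarrow> complex"
  assumes "(F has_sum s) UNIV"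
  shows "(\<lambda>j. \<Sum>m | mi_size m = j. F m) sums s"
proof (rule has_sum_imp_sums, rule has_sum_SigmaD)
  have "bij_betw snd (SIGMA j:UNIV. {m :: 'n \<Rightarrow> nat. mi_size m = j}) UNIV"
    by (rule bij_betw_byWitness[where f' = "\<lambda>m. (mi_size m, m)"]) auto
  then show "((\<lambda>p. F (snd p)) has_sum s) (SIGMA j:UNIV. {m. mi_size m = j})"
    using has_sum_reindex_bij_betw[of snd _ UNIV F s] assms by blast
  show "((\<lambda>m. F (snd (j, m))) has_sum (\<Sum>m | mi_size m = j. F m)) {m. mi_size m = j}" for j
    using has_sum_finite[OF finite_mi_size] by simp
qed

lemma hpart_sums:
  assumes "holo_on f unit_ball" "z \<in> unit_ball"
  shows "(\<lambda>j. hpart f j z) sums f z"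
  unfolding hpart_def by (rule has_sum_by_degree[OF taylor_has_sum[OF assms]])

lemma hpart_slice_sums:
  assumes "holo_on f unit_ball" "norm w * norm z < 1"
  shows "(\<lambda>j. hpart f j z * w ^ j) sums f (w *s z)"
proof -
  have "w *s z \<in> unit_ball" using assms(2) by (simp add: norm_smult_vec)
  from hpart_sums[OF assms(1) this] show ?thesis by (simp add: hpart_smult mult.commute)
qed

text \<open>On the complex line through \<open>z\<close> the homogeneous parts at \<open>z\<close> are the Taylor coefficients of \<open>f\<close>, so
the one-variable Cauchy estimate applies; the disc on the line has radius greater than \<open>1\<close>.\<close>

lemma hpart_geometric_bound:
  fixes f :: "complex ^ 'n \<Rightarrow> complex"
  assumes f: "holo_on f unit_ball" and \<rho>: "0 < \<rho>" "\<rho> < 1"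
  obtains M q where "0 < q" "q < 1" "\<And>j z. norm z \<le> \<rho> \<Longrightarrow> norm (hpart f j z) \<le> M * q ^ j"
proof -
  define \<rho>' where "\<rho>' = (1 + \<rho>) / 2"
  have \<rho>': "\<rho> < \<rho>'" "\<rho>' < 1" using \<rho> by (auto simp: \<rho>'_def)
  obtain M where M: "\<And>z. norm z \<le> \<rho>' \<Longrightarrow> norm (f z) \<le> M"
    by (rule holo_on_bounded_cball[OF f \<rho>'(2)]) (rule that)
  have *: "norm w * norm z < \<rho>'" if "norm z \<le> \<rho>" "norm w < \<rho>' / \<rho>" for z :: "complex ^ 'n" and w :: complex
  proof -
    have "norm w * norm z \<le> norm w * \<rho>" using that by (intro mult_left_mono) auto
    also have "\<dots> < \<rho>'" using that(2) \<rho> by (simp add: field_simps)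
    finally show ?thesis .
  qed
  have "norm (hpart f j z) \<le> M / (\<rho>' / \<rho>) ^ j" if z: "norm z \<le> \<rho>" for j z
  proof (rule powser_coeff_bound)
    show "\<rho>' / \<rho> > 0" using \<rho> \<rho>' by simp
    show "(\<lambda>j. hpart f j z * w ^ j) sums f (w *s z)" if "norm w < \<rho>' / \<rho>" for w
      using *[OF z that] \<rho>' by (intro hpart_slice_sums[OF f]) auto
    show "norm (f (w *s z)) \<le> M" if "norm w < \<rho>' / \<rho>" for w
      using *[OF z that] by (intro M) (simp add: norm_smult_vec)
  qed
  then show ?thesis
    using \<rho> \<rho>' by (intro that[of "\<rho> / \<rho>'" M]) (auto simp: power_divide)
qed

definition hmult :: "(nat \<Rightarrow> real) \<Rightarrow> (complex ^ 'n \<Rightarrow> complex) \<Rightarrow> complex ^ 'n \<Rightarrow> complex" where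
  "hmult c f z = (\<Sum>j. of_real (c j) * hpart f j z)"

text \<open>The radius of convergence of \<open>\<Sum>\<^sub>j c\<^sub>j x\<^sup>j\<close> is at least \<open>1\<close>: the growth of multipliers that preserves
convergence in the open ball.\<close>

definition subexponential :: "(nat \<Rightarrow> real) \<Rightarrow> bool" where
  "subexponential c \<longleftrightarrow> (\<forall>q. 0 < q \<longrightarrow> q < 1 \<longrightarrow> summable (\<lambda>j. \<bar>c j\<bar> * q ^ j))"

lemma hmult_dominated:
  fixes f :: "complex ^ 'n \<Rightarrow> complex"
  assumes f: "holo_on f unit_ball" and c: "subexponential c" and z: "z \<in> unit_ball"
  shows "\<exists>r>0. \<exists>K. ball z r \<subseteq> unit_ball \<and> summable K \<and>
           (\<forall>j. \<forall>x\<in>ball z r. norm (of_real (c j) * hpart f j x) \<le> K j)"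
proof -
  define \<rho> where "\<rho> = (1 + norm z) / 2"
  have \<rho>: "0 < \<rho>" "\<rho> < 1" "norm z < \<rho>" using z by (auto simp: \<rho>_def add_pos_nonneg)
  obtain M q where q: "0 < q" "q < 1" and M: "\<And>j z. norm z \<le> \<rho> \<Longrightarrow> norm (hpart f j z) \<le> M * q ^ j"
    by (rule hpart_geometric_bound[OF f \<rho>(1,2)]) (rule that)
  have le: "norm x < \<rho>" if "x \<in> ball z (\<rho> - norm z)" for x
    using that norm_triangle_ineq4[of z "z - x"] by (simp add: dist_norm)
  have "norm (of_real (c j) * hpart f j x) \<le> M * (\<bar>c j\<bar> * q ^ j)" if "x \<in> ball z (\<rho> - norm z)" for j x
    using mult_left_mono[OF M[of x j], of "\<bar>c j\<bar>"] le[OF that] by (simp add: norm_mult algebra_simps)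
  moreover have "summable (\<lambda>j. M * (\<bar>c j\<bar> * q ^ j))"
    using c q unfolding subexponential_def by (intro summable_mult) auto
  moreover have "ball z (\<rho> - norm z) \<subseteq> unit_ball" using le \<rho>(2) by force
  ultimately show ?thesis using \<rho>(3)
    by (intro exI[of _ "\<rho> - norm z"] conjI exI[of _ "\<lambda>j. M * (\<bar>c j\<bar> * q ^ j)"]) auto
qed

lemma hmult_sums:
  fixes f :: "complex ^ 'n \<Rightarrow> complex"
  assumes f: "holo_on f unit_ball" and c: "subexponential c" and z: "z \<in> unit_ball"
  shows "(\<lambda>j. of_real (c j) * hpart f j z) sums hmult c f z"
proof -
  obtain r K where "r > 0" and K: "summable K" "\<And>j x. x \<in> ball z r \<Longrightarrow> norm (of_real (c j) * hpart f j x) \<le> K j"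
    using hmult_dominated[OF assms] by blast
  have "norm (of_real (c j) * hpart f j z) \<le> K j" for j
    by (rule K(2)) (simp add: \<open>r > 0\<close>)
  then have "summable (\<lambda>j. of_real (c j) * hpart f j z)"
    by (rule summable_comparison_test'[OF K(1)])
  then show ?thesis unfolding hmult_def by (rule summable_sums)
qed

lemma holo_on_hmult:
  fixes f :: "complex ^ 'n \<Rightarrow> complex"
  assumes "holo_on f unit_ball" "subexponential c"
  shows "holo_on (hmult c f) unit_ball"
  by (rule holo_on_series[where F = "\<lambda>j z. of_real (c j) * hpart f j z"])
     (intro holo_on_mult holo_on_const holo_on_hpart hmult_dominated hmult_sums assms; assumption)+

lemma dilation_factor:
  assumes "0 \<le> x" "x < (1::real)"
  obtains t where "t > 1" "t * x < 1"
proof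
  show "2 / (1 + x) > 1" "2 / (1 + x) * x < 1" using assms by (auto simp: field_simps)
qed

text \<open>Passing from the sum over degrees back to the sum over multi-indices needs absolute convergence.
It holds because the Taylor series of \<open>f\<close> converges absolutely at a slightly dilated point \<open>t z\<close>
with \<open>t > 1\<close>, and the factor \<open>t\<^sup>j\<close> absorbs the multiplier.\<close>

lemma hmult_has_sum:
  fixes f :: "complex ^ 'n \<Rightarrow> complex"
  assumes f: "holo_on f unit_ball" and c: "subexponential c" and z: "z \<in> unit_ball"
  shows "((\<lambda>m. (of_real (c (mi_size m)) * taylor_coeffs f m) * mi_power z m) has_sum hmult c f z) UNIV"
proof -
  obtain t where t: "t > 1" "t * norm z < 1"
    by (rule dilation_factor[of "norm z"]) (use z in auto)
  let ?b = "\<lambda>m. (of_real (c (mi_size m)) * taylor_coeffs f m) * mi_power z m"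
  let ?a = "\<lambda>m. taylor_coeffs f m * mi_power (of_real t *s z) m"
  have "of_real t *s z \<in> unit_ball" using t by (simp add: norm_smult_vec)
  from taylor_has_sum[OF f this] have "?a summable_on UNIV" by (auto simp: summable_on_def)
  then have a: "(\<lambda>m. norm (?a m)) summable_on UNIV"
    by (simp add: summable_on_iff_abs_summable_on_complex)
  have "summable (\<lambda>j. \<bar>c j\<bar> * (1 / t) ^ j)"
    using c t unfolding subexponential_def by simp
  then have "Bseq (\<lambda>j. \<bar>c j\<bar> * (1 / t) ^ j)"
    using summable_imp_Bseq by blast
  then obtain K where K: "\<And>j. norm (\<bar>c j\<bar> * (1 / t) ^ j) \<le> K" by (auto simp: Bseq_def)
  have cK: "\<bar>c j\<bar> \<le> K * t ^ j" for j
    using K[of j] t by (simp add: abs_mult power_divide field_simps)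
  have "norm (?b m) \<le> K * norm (?a m)" for m
  proof -
    have "norm (?b m) = \<bar>c (mi_size m)\<bar> * norm (taylor_coeffs f m * mi_power z m)"
      by (simp add: norm_mult mult.assoc)
    also have "\<dots> \<le> K * t ^ mi_size m * norm (taylor_coeffs f m * mi_power z m)"
      by (intro mult_right_mono cK) auto
    also have "\<dots> = K * norm (?a m)"
      using t by (simp add: mi_power_smult norm_mult norm_power)
    finally show ?thesis .
  qed
  then have "?b summable_on UNIV"
    by (intro abs_summable_summable[OF summable_on_comparison_test[OF summable_on_cmult_right[OF a, of K]]]) auto
  then obtain s where s: "(?b has_sum s) UNIV" by (auto simp: summable_on_def)
  have "(\<Sum>m | mi_size m = j. ?b m) = of_real (c j) * hpart f j z" for j
    by (simp add: hpart_def sum_distrib_left mult.assoc)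
  then have "s = hmult c f z"
    using has_sum_by_degree[OF s] hmult_sums[OF f c z] sums_unique2 by force
  then show ?thesis using s by simp
qed

lemma hpart_hmult:
  assumes "holo_on f unit_ball" "subexponential c"
  shows "hpart (hmult c f) j z = of_real (c j) * hpart f j z"
proof -
  have "taylor_coeffs (hmult c f) = (\<lambda>m. of_real (c (mi_size m)) * taylor_coeffs f m)"
    by (rule taylor_coeffs_eqI) (use hmult_has_sum[OF assms] in blast)
  then show ?thesis by (simp add: hpart_def sum_distrib_left mult.assoc)
qed

lemma hpart_cong:
  assumes "\<And>z. z \<in> unit_ball \<Longrightarrow> f z = g z"
  shows "hpart f j z = hpart g j z"
proof -
  have "taylor_coeffs f = taylor_coeffs g" unfolding taylor_coeffs_def using assms by simp
  then show ?thesis by (simp add: hpart_def)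
qed

lemma hpart_0: "holo_on f unit_ball \<Longrightarrow> hpart f 0 z = f 0"
  using hpart_slice_sums[of f 0 z] powser_sums_zero_iff[of "\<lambda>j. hpart f j z" "f 0"] by simp

section \<open>The radial derivative as a multiplier\<close>

lemma radial_deriv_eq:
  fixes f :: "complex ^ 'n \<Rightarrow> complex"
  assumes D: "(f has_derivative D) (at z)" and lin: "\<And>c v. D (c *s v) = c * D v"
  shows "radial_deriv f z = D z"
proof -
  have "partial_deriv k f z = D (axis k 1)" for k
  proof -
    have ax: "axis k w = w *s axis k 1" for w :: complex by (simp add: vec_eq_iff axis_def)
    have "(\<lambda>w. f (z + axis k w)) = (\<lambda>w. f (z + w *s axis k 1))"
      by (rule ext, subst ax, rule refl)
    then have "partial_deriv k f z = deriv (\<lambda>w. f (z + w *s axis k 1)) 0"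
      by (simp add: partial_deriv_def)
    also have "\<dots> = D (axis k 1)"
      by (rule DERIV_imp_deriv, rule holo_on_line) (use D lin in auto)
    finally show ?thesis .
  qed
  then have "radial_deriv f z = (\<Sum>k\<in>UNIV. D ((z $ k) *s axis k 1))"
    by (simp add: radial_deriv_def lin)
  also have "\<dots> = D (\<Sum>k\<in>UNIV. (z $ k) *s axis k 1)"
    using has_derivative_linear[OF D] by (simp add: linear_sum)
  also have "(\<Sum>k\<in>UNIV. (z $ k) *s axis k 1) = z"
    by (rule basis_expansion)
  finally show ?thesis .
qed

lemma radial_deriv_slice:
  fixes f :: "complex ^ 'n \<Rightarrow> complex"
  assumes f: "holo_on f unit_ball" and z: "z \<in> unit_ball"
  shows "((\<lambda>w. f (w *s z)) has_field_derivative radial_deriv f z) (at 1)"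
proof -
  obtain D where D: "(f has_derivative D) (at z)" "\<And>c v. D (c *s v) = c * D v"
    using f z unfolding holo_on_def by blast
  have "((\<lambda>w. f (0 + w *s z)) has_field_derivative D z) (at 1)"
    by (rule holo_on_line) (use D in auto)
  then show ?thesis using radial_deriv_eq[OF D] by simp
qed

text \<open>Euler's identity: the radial derivative is the derivative of \<open>w \<mapsto> f (w z) = \<Sum>\<^sub>j f\<^sub>j z w\<^sup>j\<close> at
\<open>w = 1\<close>, which is an interior point of the disc of convergence.\<close>

lemma radial_deriv_sums:
  fixes f :: "complex ^ 'n \<Rightarrow> complex"
  assumes f: "holo_on f unit_ball" and z: "z \<in> unit_ball"
  shows "(\<lambda>j. of_nat j * hpart f j z) sums radial_deriv f z"
proof -
  obtain t where t: "t > 1" "t * norm z < 1"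
    by (rule dilation_factor[of "norm z"]) (use z in auto)
  define c where "c j = hpart f j z" for j
  have sums: "(\<lambda>j. c j * w ^ j) sums f (w *s z)" if "norm w < t" for w
  proof -
    have "norm w * norm z \<le> t * norm z" using that by (intro mult_right_mono) auto
    then show ?thesis unfolding c_def using t by (intro hpart_slice_sums[OF f]) auto
  qed
  have summ: "summable (\<lambda>j. c j * w ^ j)" if "norm w < t" for w
    using sums[OF that] by (rule sums_summable)
  have "((\<lambda>w. \<Sum>j. c j * w ^ j) has_field_derivative (\<Sum>j. diffs c j * 1 ^ j)) (at 1)"
    by (rule termdiffs_strong'[OF summ]) (use t in auto)
  then have "((\<lambda>w. f (w *s z)) has_field_derivative (\<Sum>j. diffs c j * 1 ^ j)) (at 1)"
    by (rule has_field_derivative_transform_within_open[where S = "ball 0 t"])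
       (use t sums_unique[OF sums] in auto)
  then have "radial_deriv f z = (\<Sum>j. diffs c j * 1 ^ j)"
    using radial_deriv_slice[OF f z] DERIV_unique by blast
  moreover have "(\<lambda>j. of_nat j * c j * 1 ^ (j - Suc 0)) sums (\<Sum>j. diffs c j * 1 ^ j)"
    by (rule diffs_equiv, rule termdiff_converges[where K = t]) (use t summ in auto)
  ultimately show ?thesis by (simp add: c_def)
qed

text \<open>Half of the decay of \<open>q\<^sup>j\<close> beats the power, the other half gives a geometric majorant. As
\<open>0 powr s = 0\<close> for every \<open>s\<close>, the multiplier \<open>j powr s\<close> deletes the constant term even when \<open>s = 0\<close>.\<close>

lemma subexponential_powr: "subexponential (\<lambda>j. real j powr s)"
  unfolding subexponential_def
proof (intro allI impI)
  fix q :: real assume q: "0 < q" "q < 1"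
  define p where "p = sqrt q"
  have p: "0 < p" "p < 1" "q = p * p" using q by (auto simp: p_def)
  have "(\<lambda>j::nat. real j powr s * p ^ j) \<longlonglongrightarrow> 0"
    using p by real_asymp
  then have "Bseq (\<lambda>j::nat. real j powr s * p ^ j)" by (intro convergent_imp_Bseq convergentI)
  then obtain K where K: "\<And>j::nat. norm (real j powr s * p ^ j) \<le> K" by (auto simp: Bseq_def)
  have le: "norm (\<bar>real j powr s\<bar> * q ^ j) \<le> K * p ^ j" for j
    using mult_right_mono[OF K[of j], of "p ^ j"] p by (simp add: abs_mult power_mult_distrib mult.assoc)
  have "summable (\<lambda>j. K * p ^ j)"
    using p by (intro summable_mult summable_geometric) simp
  then show "summable (\<lambda>j. \<bar>real j powr s\<bar> * q ^ j)"
    by (rule summable_comparison_test') (rule le)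
qed

lemma radial_deriv_hmult:
  fixes f :: "complex ^ 'n \<Rightarrow> complex"
  assumes f: "holo_on f unit_ball" and z: "z \<in> unit_ball"
  shows "radial_deriv f z = hmult (\<lambda>j. real j powr 1) f z"
  using sums_unique[OF radial_deriv_sums[OF assms]] by (simp add: hmult_def)

lemma holo_on_radial_deriv:
  fixes f :: "complex ^ 'n \<Rightarrow> complex"
  assumes "holo_on f unit_ball"
  shows "holo_on (radial_deriv f) unit_ball"
  by (rule holo_on_cong[OF _ _ holo_on_hmult[OF assms subexponential_powr[of 1]]])
     (use radial_deriv_hmult[OF assms] in auto)

lemma hpart_radial_deriv:
  fixes f :: "complex ^ 'n \<Rightarrow> complex"
  assumes "holo_on f unit_ball"
  shows "hpart (radial_deriv f) j z = of_nat j * hpart f j z"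
  using hpart_hmult[OF assms subexponential_powr[of 1], of j z]
  by (subst hpart_cong[of _ "hmult (\<lambda>j. real j powr 1) f"]) (use radial_deriv_hmult[OF assms] in auto)

lemma holo_on_radial_deriv_iter:
  fixes f :: "complex ^ 'n \<Rightarrow> complex"
  assumes "holo_on f unit_ball"
  shows "holo_on ((radial_deriv ^^ k) f) unit_ball"
  using assms by (induction k) (auto intro: holo_on_radial_deriv)

lemma hpart_radial_deriv_iter:
  fixes f :: "complex ^ 'n \<Rightarrow> complex"
  assumes "holo_on f unit_ball"
  shows "hpart ((radial_deriv ^^ k) f) j z = of_nat j ^ k * hpart f j z"
  by (induction k) (auto simp: hpart_radial_deriv holo_on_radial_deriv_iter assms)


section \<open>Growth estimates\<close>

definition growth :: "real \<Rightarrow> real \<Rightarrow> (complex ^ 'n \<Rightarrow> complex) \<Rightarrow> bool" where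
  "growth a A h \<longleftrightarrow> (\<forall>z\<in>unit_ball. norm (h z) \<le> A * (1 - (norm z)\<^sup>2) powr (-a))"

lemma one_minus_norm_sq_pos: "z \<in> unit_ball \<Longrightarrow> 0 < 1 - (norm z)\<^sup>2"
  by (simp add: power_less_one_iff abs_square_less_1)

lemma growthD: "growth a A h \<Longrightarrow> norm z < 1 \<Longrightarrow> norm (h z) \<le> A * (1 - (norm z)\<^sup>2) powr (-a)"
  by (simp add: growth_def)

lemma growth_nonneg: "growth a A h \<Longrightarrow> A \<ge> 0"
  using growthD[of a A h 0] order_trans[OF norm_ge_zero[of "h 0"]] by simp

lemma growth_mono_inside:
  assumes "growth a A h" "a \<ge> 0" "norm z < 1" "0 < d" "d \<le> 1 - (norm z)\<^sup>2"
  shows "norm (h z) \<le> A * d powr (-a)"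
proof -
  have "(1 - (norm z)\<^sup>2) powr (-a) \<le> d powr (-a)"
    using assms by (intro powr_mono2') auto
  then show ?thesis
    using growthD[OF assms(1,3)] growth_nonneg[OF assms(1)] mult_left_mono order_trans by blast
qed

text \<open>Cauchy's inequality on the ball of radius \<open>(1 - \<bar>z\<bar>) / 2\<close> about \<open>z\<close>, where the weight
\<open>1 - \<bar>y\<bar>\<^sup>2\<close> is at least a quarter of its value at \<open>z\<close>.\<close>

lemma growth_radial_deriv:
  fixes h :: "complex ^ 'n \<Rightarrow> complex"
  assumes h: "holo_on h unit_ball" and gr: "growth a A h" and a: "a \<ge> 0"
  shows "growth (a + 1) (4 powr (a + 1) * A) (radial_deriv h)"
  unfolding growth_def
proof
  fix z :: "complex ^ 'n" assume z: "z \<in> unit_ball"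
  define \<delta> where "\<delta> = 1 - (norm z)\<^sup>2"
  have \<delta>: "\<delta> > 0" unfolding \<delta>_def by (rule one_minus_norm_sq_pos[OF z])
  define \<rho> where "\<rho> = (1 - norm z) / 2"
  have nz: "norm z < 1" using z by simp
  have \<rho>: "\<rho> > 0" "\<delta> / 4 \<le> \<rho>"
  proof -
    show "\<rho> > 0" using nz by (simp add: \<rho>_def)
    have "(1 - norm z) * (1 + norm z) \<le> (1 - norm z) * 2"
      using nz by (intro mult_left_mono) auto
    then have "\<delta> \<le> 4 * \<rho>" by (simp add: \<delta>_def \<rho>_def power2_eq_square algebra_simps)
    then show "\<delta> / 4 \<le> \<rho>" by simp
  qed
  have in_ball: "norm y < 1 \<and> \<delta> / 4 \<le> 1 - (norm y)\<^sup>2" if "y \<in> ball z \<rho>" for y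
  proof -
    have le: "norm y < norm z + \<rho>"
      using that norm_triangle_ineq4[of z "z - y"] by (simp add: dist_norm)
    have mid: "norm z + \<rho> = 1 - \<rho>" by (simp add: \<rho>_def field_simps)
    have "norm y < 1" using le mid \<rho>(1) by linarith
    then have "(norm y)\<^sup>2 \<le> norm y" by (simp add: power2_eq_square mult_left_le_one_le)
    then show ?thesis using \<open>norm y < 1\<close> le mid \<rho>(2) by linarith
  qed
  obtain D where D: "(h has_derivative D) (at z)" "\<And>c v. D (c *s v) = c * D v"
    using h z unfolding holo_on_def by blast
  have A: "A \<ge> 0" by (rule growth_nonneg[OF gr])
  have "norm (radial_deriv h z) = norm (D z)" using radial_deriv_eq[OF D] by simp
  also have "\<dots> \<le> (A * (\<delta> / 4) powr (-a)) / \<rho> * norm z"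
  proof (rule derivative_Cauchy_bound[OF _ \<rho>(1) _ D])
    show "holo_on h (ball z \<rho>)"
      by (rule holo_on_subset[OF h]) (use in_ball in auto)
    show "norm (h y) \<le> A * (\<delta> / 4) powr (-a)" if "y \<in> ball z \<rho>" for y
      using growth_mono_inside[OF gr a, of y "\<delta> / 4"] in_ball[OF that] \<delta> by simp
  qed
  also have "\<dots> \<le> (A * (\<delta> / 4) powr (-a)) / \<rho> * 1"
    using A \<rho> nz by (intro mult_left_mono divide_nonneg_nonneg mult_nonneg_nonneg) auto
  also have "\<dots> \<le> (A * (\<delta> / 4) powr (-a)) / (\<delta> / 4)"
    using A \<rho> \<delta> by (simp only: mult_1_right) (intro divide_left_mono, auto)
  also have "\<dots> = A * (\<delta> / 4) powr (- (a + 1))"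
    using \<delta> by (simp add: powr_diff powr_one)
  also have "(\<delta> / 4) powr (- (a + 1)) = 4 powr (a + 1) * \<delta> powr (- (a + 1))"
    using \<delta> by (simp only: powr_minus) (simp add: powr_divide field_simps)
  finally show "norm (radial_deriv h z) \<le> 4 powr (a + 1) * A * (1 - (norm z)\<^sup>2) powr (- (a + 1))"
    by (simp add: \<delta>_def algebra_simps)
qed

lemma growth_radial_deriv_iter:
  assumes "a \<ge> 0"
  shows "\<exists>C\<ge>0. \<forall>(h :: complex ^ 'n \<Rightarrow> complex) A. holo_on h unit_ball \<longrightarrow> growth a A h \<longrightarrow>
           growth (a + real N) (C * A) ((radial_deriv ^^ N) h)"
proof (induction N)
  case 0
  show ?case by (intro exI[of _ 1]) auto
next
  case (Suc N)
  then obtain C where C: "C \<ge> 0" "\<And>(h :: complex ^ 'n \<Rightarrow> complex) A. holo_on h unit_ball \<Longrightarrow> growth a A h \<Longrightarrow>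
           growth (a + real N) (C * A) ((radial_deriv ^^ N) h)"
    by blast
  have "growth (a + real (Suc N)) (4 powr (a + real N + 1) * C * A) ((radial_deriv ^^ Suc N) h)"
    if "holo_on h unit_ball" "growth a A h" for h :: "complex ^ 'n \<Rightarrow> complex" and A
    using growth_radial_deriv[OF holo_on_radial_deriv_iter[OF that(1)] C(2)[OF that]] assms
    by (simp add: algebra_simps)
  then show ?case using C(1) by (intro exI[of _ "4 powr (a + real N + 1) * C"]) auto
qed

text \<open>A Schwarz-type estimate. The additional factor \<open>\<bar>w\<bar>\<close> becomes the factor \<open>exp (-t)\<close> that makes the
fractional integral converge at infinity. Near \<open>0\<close> it comes from the mean value inequality, and away
from \<open>0\<close> it is bounded below.\<close>

lemma growth_diff_at_0:
  fixes h :: "complex ^ 'n \<Rightarrow> complex"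
  assumes h: "holo_on h unit_ball" and gr: "growth a A h" and a: "a \<ge> 0" and w: "norm w < 1"
  shows "norm (h w - h 0) \<le> (8 + 4 * (3/4) powr (-a)) * A * norm w * (1 - (norm w)\<^sup>2) powr (-a)"
proof -
  have A: "A \<ge> 0" by (rule growth_nonneg[OF gr])
  define p where "p = (1 - (norm w)\<^sup>2) powr (-a)"
  have sq: "(norm w)\<^sup>2 < 1" using w by (simp add: power_less_one_iff abs_square_less_1)
  have p: "p \<ge> 1"
    unfolding p_def using powr_mono2'[of "-a" "1 - (norm w)\<^sup>2" 1] sq a by simp
  show ?thesis
  proof (cases "norm w \<le> 1/4")
    case True
    define S where "S = cball (0 :: complex ^ 'n) (1/4)"
    define K where "K = A * (3/4) powr (-a)"
    have K: "K \<ge> 0" using A by (simp add: K_def)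
    have "\<forall>x\<in>S. \<exists>D. (h has_derivative D) (at x) \<and> (\<forall>c v. D (c *s v) = c * D v)"
      using h by (auto simp: holo_on_def S_def)
    then obtain D where D: "\<And>x. x \<in> S \<Longrightarrow> (h has_derivative D x) (at x)"
      "\<And>x c v. x \<in> S \<Longrightarrow> D x (c *s v) = c * D x v" by metis
    have "norm (h w - h 0) \<le> 4 * K * norm (w - 0)"
    proof (rule differentiable_bound[of S h D])
      show "convex S" "w \<in> S" "0 \<in> S" using True by (auto simp: S_def)
      show "(h has_derivative D x) (at x within S)" if "x \<in> S" for x
        by (rule has_derivative_at_withinI[OF D(1)[OF that]])
      show "onorm (D x) \<le> 4 * K" if x: "x \<in> S" for x
      proof (rule onorm_le)
        fix v
        have half: "norm y \<le> 1/2" if "y \<in> ball x (1/4)" for y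
          using that x norm_triangle_ineq4[of x "x - y"] by (simp add: dist_norm S_def)
        have "norm (D x v) \<le> K / (1/4) * norm v"
        proof (rule derivative_Cauchy_bound)
          show "holo_on h (ball x (1/4))"
            by (rule holo_on_subset[OF h]) (use half in fastforce)
          show "norm (h y) \<le> K" if "y \<in> ball x (1/4)" for y
          proof -
            have "(norm y)\<^sup>2 \<le> (1/2)\<^sup>2" by (rule power_mono[OF half[OF that]]) simp
            then show ?thesis unfolding K_def using half[OF that]
              by (intro growth_mono_inside[OF gr a]) (auto simp: power2_eq_square)
          qed
        qed (use D x in auto)
        then show "norm (D x v) \<le> 4 * K * norm v" by simp
      qed
    qed
    also have "\<dots> = 4 * K * norm w * 1" by simp
    also have "\<dots> \<le> 4 * K * norm w * p" using p K by (intro mult_left_mono) auto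
    also have "\<dots> \<le> (8 * A + 4 * K) * norm w * p"
      using A p by (intro mult_right_mono) auto
    finally show ?thesis by (simp add: K_def p_def algebra_simps)
  next
    case False
    have "norm (h w - h 0) \<le> norm (h w) + norm (h 0)" by (rule norm_triangle_ineq4)
    also have "\<dots> \<le> A * p + A * 1"
      using growthD[OF gr w] growthD[OF gr, of 0] by (simp add: p_def)
    also have "\<dots> \<le> A * p + A * p" using p A by (intro add_left_mono mult_left_mono) auto
    also have "\<dots> = 8 * A * (1/4) * p" by simp
    also have "\<dots> \<le> 8 * A * norm w * p"
      using False A p by (intro mult_right_mono mult_left_mono) auto
    also have "\<dots> \<le> (8 + 4 * (3/4) powr (-a)) * A * norm w * p"
      using A p by (intro mult_right_mono) auto
    finally show ?thesis by (simp add: p_def)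
  qed
qed

lemma Gamma_integral_scaled:
  assumes \<sigma>: "\<sigma> > 0" and j: "(j::nat) \<ge> 1"
  shows "((\<lambda>t. t powr (\<sigma> - 1) * exp (- real j * t)) has_integral (Gamma \<sigma> * real j powr (-\<sigma>))) {0..}"
proof -
  define g :: "real \<Rightarrow> real" where "g t = indicator {0..} t * t powr (\<sigma> - 1) / exp t" for t
  have [measurable]: "g \<in> borel_measurable borel" unfolding g_def by measurable
  have "ennreal (Gamma \<sigma>) = (\<integral>\<^sup>+t. ennreal (g t) \<partial>lborel)"
    unfolding g_def by (rule Gamma_conv_nn_integral_real[OF \<sigma>])
  also have "\<dots> = ennreal \<bar>real j\<bar> * (\<integral>\<^sup>+t. ennreal (g (0 + real j * t)) \<partial>lborel)"
    by (rule nn_integral_real_affine) (use j in auto)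
  finally have "ennreal (Gamma \<sigma>) = ennreal (real j) * (\<integral>\<^sup>+t. ennreal (g (real j * t)) \<partial>lborel)"
    by simp
  then have "ennreal (1 / real j) * ennreal (Gamma \<sigma>) =
      (ennreal (1 / real j) * ennreal (real j)) * (\<integral>\<^sup>+t. ennreal (g (real j * t)) \<partial>lborel)"
    by (simp add: mult.assoc)
  moreover have "ennreal (1 / real j) * ennreal (real j) = 1"
    using j by (simp flip: ennreal_mult')
  moreover have "ennreal (1 / real j) * ennreal (Gamma \<sigma>) = ennreal (Gamma \<sigma> / real j)"
    by (simp flip: ennreal_mult')
  ultimately have "(\<integral>\<^sup>+t. ennreal (g (real j * t)) \<partial>lborel) = ennreal (Gamma \<sigma> / real j)"
    by simp
  then have "((\<lambda>t. g (real j * t)) has_integral (Gamma \<sigma> / real j)) UNIV"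
    using Gamma_real_pos[OF \<sigma>] by (intro nn_integral_has_integral) (auto simp: g_def)
  from has_integral_mult_right[OF this, of "real j powr (1 - \<sigma>)"]
  have I: "((\<lambda>t. real j powr (1 - \<sigma>) * g (real j * t)) has_integral (real j powr (1 - \<sigma>) * (Gamma \<sigma> / real j))) UNIV" .
  have eq: "real j powr (1 - \<sigma>) * g (real j * t) =
      (if t \<in> {0..} then t powr (\<sigma> - 1) * exp (- real j * t) else 0)" for t
  proof (cases "t \<ge> 0")
    case True
    have "real j powr (1 - \<sigma>) * real j powr (\<sigma> - 1) = 1" using j by (simp flip: powr_add)
    then show ?thesis using True j
      by (simp add: g_def powr_mult exp_minus field_simps)
  next
    case False
    then show ?thesis using j by (simp add: g_def zero_le_mult_iff)
  qed
  have "real j powr (1 - \<sigma>) * (Gamma \<sigma> / real j) = Gamma \<sigma> * real j powr (-\<sigma>)"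
    using j by (simp add: powr_diff powr_minus field_simps)
  with I show ?thesis unfolding eq has_integral_restrict_UNIV by simp
qed

text \<open>For \<open>\<rho> \<le> exp (-t)\<close> the weight \<open>1 - \<rho>\<^sup>2\<close> is at least \<open>1 - exp (-2t) \<ge> t / (1 + 2t)\<close>; the loss for
large \<open>t\<close>, namely \<open>(1 + 2t) powr a\<close>, is compensated by \<open>exp (-t)\<close>. The constant comes from
\<open>1 + 2t \<le> max 1 (2a) * (1 + t/a)\<close>.\<close>

lemma exp_weight_bound:
  fixes a t \<rho> :: real
  assumes a: "a > 0" and t: "t > 0" and \<rho>: "0 \<le> \<rho>" "\<rho> \<le> exp (-t)"
  shows "exp (-t) * (1 - \<rho>\<^sup>2) powr (-a) \<le> (max 1 (2 * a)) powr a * t powr (-a)"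
proof -
  define c where "c = max 1 (2 * a)"
  have c: "c \<ge> 1" "2 * a \<le> c" by (auto simp: c_def)
  have "1 + 2 * t \<le> c * (1 + t / a)"
  proof -
    have "2 * t \<le> c * (t / a)" using c(2) a t by (simp add: field_simps)
    then show ?thesis using c(1) by (simp add: algebra_simps)
  qed
  also have "\<dots> \<le> c * exp (t / a)" using c by (intro mult_left_mono) auto
  finally have "(1 + 2 * t) powr a \<le> (c * exp (t / a)) powr a"
    using a t by (intro powr_mono2) auto
  also have "\<dots> = c powr a * exp t" using c a by (simp add: powr_mult exp_powr_real)
  finally have 1: "exp (-t) * (1 + 2 * t) powr a \<le> c powr a"
    by (simp add: exp_minus field_simps)
  have "exp (2 * t) * \<rho>\<^sup>2 \<le> exp (2 * t) * (exp (-t))\<^sup>2"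
    using \<rho> by (intro mult_left_mono power_mono) auto
  also have "\<dots> = 1" by (simp flip: exp_add exp_double add: power2_eq_square)
  finally have "exp (2 * t) * \<rho>\<^sup>2 \<le> 1" .
  moreover have "(1 + 2 * t) * \<rho>\<^sup>2 \<le> exp (2 * t) * \<rho>\<^sup>2"
    by (intro mult_right_mono exp_ge_add_one_self) auto
  ultimately have "t / (1 + 2 * t) \<le> 1 - \<rho>\<^sup>2"
    using t by (simp add: field_simps)
  then have "(1 - \<rho>\<^sup>2) powr (-a) \<le> (t / (1 + 2 * t)) powr (-a)"
    using a t by (intro powr_mono2') auto
  also have "\<dots> = t powr (-a) * (1 + 2 * t) powr a"
    using t by (simp add: powr_divide powr_minus field_simps)
  finally have "exp (-t) * (1 - \<rho>\<^sup>2) powr (-a) \<le> t powr (-a) * (exp (-t) * (1 + 2 * t) powr a)"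
    using mult_left_mono[of _ _ "exp (-t)"] by (fastforce simp: algebra_simps)
  also have "\<dots> \<le> t powr (-a) * c powr a" by (intro mult_left_mono 1) auto
  finally show ?thesis by (simp add: c_def algebra_simps)
qed

text \<open>The majorant of the fractional integral: up to \<open>t = \<delta>\<close> the distance of \<open>z\<close> to the sphere limits
the size of \<open>h (exp (-t) z)\<close>, beyond it the dilation does. The condition \<open>\<sigma> > 0\<close> is used at \<open>0\<close>
and \<open>\<sigma> < a\<close> at infinity.\<close>

lemma two_regime_integral:
  fixes a \<sigma> \<delta> K :: real
  assumes \<sigma>: "0 < \<sigma>" "\<sigma> < a" and \<delta>: "\<delta> > 0"
  shows "((\<lambda>t. if t \<le> \<delta> then \<delta> powr (-a) * t powr (\<sigma> - 1) else K * t powr (\<sigma> - 1 - a)) has_integral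
          ((1 / \<sigma> + K / (a - \<sigma>)) * \<delta> powr (\<sigma> - a))) {0..}"
    (is "(?G has_integral _) _")
proof -
  have "((\<lambda>t. \<delta> powr (-a) * t powr (\<sigma> - 1)) has_integral (\<delta> powr (-a) * (\<delta> powr (\<sigma> - 1 + 1) / (\<sigma> - 1 + 1)))) {0..\<delta>}"
    by (intro has_integral_mult_right has_integral_powr_from_0) (use \<sigma> \<delta> in auto)
  then have 1: "(?G has_integral (\<delta> powr (-a) * (\<delta> powr (\<sigma> - 1 + 1) / (\<sigma> - 1 + 1)))) {0..\<delta>}"
    by (rule has_integral_eq[rotated]) auto
  have "((\<lambda>t. K * t powr (\<sigma> - 1 - a)) has_integral (K * (- (\<delta> powr (\<sigma> - 1 - a + 1)) / (\<sigma> - 1 - a + 1)))) {\<delta>..}"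
    by (intro has_integral_mult_right has_integral_powr_to_inf) (use \<sigma> \<delta> in auto)
  then have 2: "(?G has_integral (K * (- (\<delta> powr (\<sigma> - 1 - a + 1)) / (\<sigma> - 1 - a + 1)))) {\<delta>..}"
    by (rule has_integral_spike[of "{\<delta>}", rotated 2]) auto
  have "negligible ({0..\<delta>} \<inter> {\<delta>..})"
    by (rule negligible_subset[of "{\<delta>}"]) auto
  moreover have "{0..\<delta>} \<union> {\<delta>..} = {0..}" using \<delta> by auto
  moreover note has_integral_Un[OF 1 2]
  ultimately
  have int: "(?G has_integral (\<delta> powr (-a) * (\<delta> powr (\<sigma> - 1 + 1) / (\<sigma> - 1 + 1)) +
      K * (- (\<delta> powr (\<sigma> - 1 - a + 1)) / (\<sigma> - 1 - a + 1)))) {0..}"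
    by simp
  have e1: "\<delta> powr (-a) * (\<delta> powr (\<sigma> - 1 + 1) / (\<sigma> - 1 + 1)) = 1 / \<sigma> * \<delta> powr (\<sigma> - a)"
    using \<delta> by (simp add: powr_diff powr_minus field_simps)
  have e2: "- (\<delta> powr (\<sigma> - 1 - a + 1)) / (\<sigma> - 1 - a + 1) = 1 / (a - \<sigma>) * \<delta> powr (\<sigma> - a)"
    using \<sigma> by (simp add: divide_simps) (simp add: algebra_simps)
  have "1 / \<sigma> * x + K * (1 / (a - \<sigma>) * x) = (1 / \<sigma> + K / (a - \<sigma>)) * x" for x
    by (simp add: algebra_simps)
  with int show ?thesis unfolding e1 e2 by simp
qed

text \<open>Fractional integration. The integral representation is applied to partial sums only, so no integral
and infinite sum have to be interchanged: a partial sum, without its constant term, differs from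
\<open>h (exp (-t) z) - h 0\<close> by at most \<open>\<epsilon>\<^sub>N exp (-t)\<close>, where \<open>\<epsilon>\<^sub>N\<close> is the tail of
\<open>\<Sum>\<^sub>j \<bar>h\<^sub>j z\<bar>\<close>, and this contributes \<open>\<epsilon>\<^sub>N \<Gamma>(\<sigma>)\<close> to the integral, which vanishes in the limit.\<close>

lemma growth_hmult_negative:
  fixes a \<sigma> :: real
  assumes \<sigma>: "0 < \<sigma>" "\<sigma> < a"
  shows "\<exists>C\<ge>0. \<forall>(h :: complex ^ 'n \<Rightarrow> complex) A. holo_on h unit_ball \<longrightarrow> growth a A h \<longrightarrow>
           growth (a - \<sigma>) (C * A) (hmult (\<lambda>j. real j powr (-\<sigma>)) h)"
proof -
  define C0 where "C0 = 8 + 4 * (3/4) powr (-a)"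
  define K where "K = (max 1 (2 * a)) powr a"
  define I where "I = 1 / \<sigma> + K / (a - \<sigma>)"
  have C0: "C0 \<ge> 0" and K: "K \<ge> 0" by (auto simp: C0_def K_def)
  have I: "I \<ge> 0" using \<sigma> K by (simp add: I_def)
  have G: "Gamma \<sigma> > 0" by (rule Gamma_real_pos[OF \<sigma>(1)])
  have main: "growth (a - \<sigma>) (C0 * I / Gamma \<sigma> * A) (hmult (\<lambda>j. real j powr (-\<sigma>)) h)"
    if h: "holo_on h unit_ball" and gr: "growth a A h" for h :: "complex ^ 'n \<Rightarrow> complex" and A
    unfolding growth_def
  proof
    fix z :: "complex ^ 'n" assume z: "z \<in> unit_ball"
    have A: "A \<ge> 0" by (rule growth_nonneg[OF gr])
    define \<delta> where "\<delta> = 1 - (norm z)\<^sup>2"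
    have \<delta>: "\<delta> > 0" unfolding \<delta>_def by (rule one_minus_norm_sq_pos[OF z])
    define H where "H j = hpart h j z" for j
    define P where "P N = (\<Sum>j<N. of_real (real j powr (-\<sigma>)) * H j)" for N
    have "summable (\<lambda>j. norm (H j))"
    proof -
      obtain r L where "r > 0" and L: "summable L" "\<And>j x. x \<in> ball z r \<Longrightarrow> norm (of_real 1 * hpart h j x) \<le> L j"
        using hmult_dominated[OF h, of "\<lambda>_. 1" z] z by (auto simp: subexponential_def)
      have "norm (norm (H j)) \<le> L j" for j
        using L(2)[of z j] \<open>r > 0\<close> by (simp add: H_def)
      then show ?thesis by (rule summable_comparison_test'[OF L(1)])
    qed
    note sH = this
    define \<epsilon> where "\<epsilon> N = (\<Sum>j. norm (H (j + N)))" for N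
    have \<epsilon>_lim: "\<epsilon> \<longlonglongrightarrow> 0"
      unfolding \<epsilon>_def by (rule suminf_exist_split2[OF sH])
    have \<epsilon>_nonneg: "\<epsilon> N \<ge> 0" for N
      unfolding \<epsilon>_def by (intro suminf_nonneg summable_ignore_initial_segment sH) auto
    have pointwise: "norm (\<Sum>j\<in>{1..<N}. H j * of_real (exp (- real j * t))) \<le>
        C0 * A * (if t \<le> \<delta> then \<delta> powr (-a) else K * t powr (-a)) + \<epsilon> N * exp (-t)"
      if t: "t > 0" and N: "N \<ge> 1" for t N
    proof -
      define w where "w = complex_of_real (exp (-t))"
      have nw: "norm w = exp (-t)" by (simp add: w_def)
      have wj: "w ^ j = of_real (exp (- real j * t))" for j
        by (simp add: w_def flip: of_real_power exp_of_nat_mult)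
      have w1: "norm w \<le> 1" using t by (simp add: nw)
      have wz: "norm (w *s z) \<le> norm z" "norm (w *s z) \<le> exp (-t)"
        using mult_right_mono[OF w1, of "norm z"] mult_left_mono[of "norm z" 1 "exp (-t)"] z nw
        by (auto simp: norm_smult_vec)
      have sums: "(\<lambda>j. H j * w ^ j) sums h (w *s z)"
        unfolding H_def by (rule hpart_slice_sums[OF h]) (use wz z in \<open>simp add: norm_smult_vec\<close>)
      have tail: "norm (\<Sum>j. H (j + N) * w ^ (j + N)) \<le> \<epsilon> N * exp (-t)"
      proof -
        have "norm (H (j + N) * w ^ (j + N)) \<le> norm (H (j + N)) * exp (-t)" for j
        proof -
          have "norm w ^ (j + N) \<le> norm w ^ 1" using N w1 by (intro power_decreasing) auto
          then show ?thesis by (simp add: norm_mult norm_power nw mult_left_mono)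
        qed
        moreover have sN: "summable (\<lambda>j. norm (H (j + N)))" by (rule summable_ignore_initial_segment[OF sH])
        ultimately have "norm (\<Sum>j. H (j + N) * w ^ (j + N)) \<le> (\<Sum>j. norm (H (j + N)) * exp (-t))"
          by (intro norm_suminf_le summable_mult2)
        also have "\<dots> = \<epsilon> N * exp (-t)" unfolding \<epsilon>_def by (rule suminf_mult2[OF sN, symmetric])
        finally show ?thesis .
      qed
      \<comment> \<open>The term of degree 0, which the multiplier deletes, is the value at the origin.\<close>
      have split: "(\<Sum>j<N. H j * w ^ j) = h 0 + (\<Sum>j\<in>{1..<N}. H j * w ^ j)"
      proof -
        have "{..<N} = insert 0 {1..<N}" using N by auto
        then show ?thesis by (simp add: H_def hpart_0[OF h])
      qed
      have "h (w *s z) = (\<Sum>j. H (j + N) * w ^ (j + N)) + (\<Sum>j<N. H j * w ^ j)"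
        using suminf_split_initial_segment[OF sums_summable[OF sums], of N] sums_unique[OF sums] by simp
      then have "(\<Sum>j\<in>{1..<N}. H j * w ^ j) = (h (w *s z) - h 0) - (\<Sum>j. H (j + N) * w ^ (j + N))"
        unfolding split by simp
      then have "norm (\<Sum>j\<in>{1..<N}. H j * w ^ j) \<le> norm (h (w *s z) - h 0) + \<epsilon> N * exp (-t)"
        using norm_triangle_ineq4[of "h (w *s z) - h 0" "\<Sum>j. H (j + N) * w ^ (j + N)"] tail by simp
      moreover have "norm (h (w *s z) - h 0) \<le> C0 * A * (if t \<le> \<delta> then \<delta> powr (-a) else K * t powr (-a))"
      proof -
        define \<rho> where "\<rho> = norm (w *s z)"
        have \<rho>: "0 \<le> \<rho>" "\<rho> \<le> norm z" "\<rho> \<le> exp (-t)" "\<rho> < 1" using wz z by (auto simp: \<rho>_def)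
        have le: "\<rho> * (1 - \<rho>\<^sup>2) powr (-a) \<le> exp (-t) * (1 - \<rho>\<^sup>2) powr (-a)"
          using \<rho> by (intro mult_right_mono) auto
        have "\<rho> * (1 - \<rho>\<^sup>2) powr (-a) \<le> (if t \<le> \<delta> then \<delta> powr (-a) else K * t powr (-a))"
        proof (cases "t \<le> \<delta>")
          case True
          have "\<delta> \<le> 1 - \<rho>\<^sup>2" using power_mono[OF \<rho>(2,1), of 2] by (simp add: \<delta>_def)
          then have "(1 - \<rho>\<^sup>2) powr (-a) \<le> \<delta> powr (-a)" using \<delta> \<sigma> by (intro powr_mono2') auto
          then have "\<rho> * (1 - \<rho>\<^sup>2) powr (-a) \<le> 1 * \<delta> powr (-a)"
            using \<rho> by (intro mult_mono) auto
          then show ?thesis using True by simp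
        next
          case False
          have "\<rho> * (1 - \<rho>\<^sup>2) powr (-a) \<le> K * t powr (-a)"
            unfolding K_def using \<sigma> by (intro order_trans[OF le] exp_weight_bound t \<rho>) auto
          then show ?thesis using False by simp
        qed
        then have "C0 * A * (\<rho> * (1 - \<rho>\<^sup>2) powr (-a)) \<le> C0 * A * (if t \<le> \<delta> then \<delta> powr (-a) else K * t powr (-a))"
          using C0 A by (intro mult_left_mono) auto
        moreover have "norm (h (w *s z) - h 0) \<le> C0 * A * (\<rho> * (1 - \<rho>\<^sup>2) powr (-a))"
          using growth_diff_at_0[OF h gr, of "w *s z"] \<sigma> \<rho>(4)
          by (simp add: \<rho>_def C0_def mult.assoc)
        ultimately show ?thesis by linarith
      qed
      ultimately show ?thesis by (simp add: wj)
    qed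
    have bound: "Gamma \<sigma> * norm (P N) \<le> C0 * A * (I * \<delta> powr (\<sigma> - a)) + \<epsilon> N * Gamma \<sigma>" if N: "N \<ge> 1" for N
    proof -
      let ?F = "\<lambda>t. \<Sum>j\<in>{1..<N}. H j * of_real (t powr (\<sigma> - 1) * exp (- real j * t))"
      let ?B = "\<lambda>t. C0 * A * (if t \<le> \<delta> then \<delta> powr (-a) * t powr (\<sigma> - 1) else K * t powr (\<sigma> - 1 - a))
                    + \<epsilon> N * (t powr (\<sigma> - 1) / exp t)"
      have "(?F has_integral (\<Sum>j\<in>{1..<N}. H j * of_real (Gamma \<sigma> * real j powr (-\<sigma>)))) {0..}"
        by (intro has_integral_sum has_integral_mult_right has_integral_of_real Gamma_integral_scaled \<sigma>) auto
      moreover have "(\<Sum>j\<in>{1..<N}. H j * of_real (Gamma \<sigma> * real j powr (-\<sigma>))) = of_real (Gamma \<sigma>) * P N"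
      proof -
        have "{..<N} = insert 0 {1..<N}" using N by auto
        then have "P N = (\<Sum>j\<in>{1..<N}. of_real (real j powr (-\<sigma>)) * H j)" by (simp add: P_def)
        then show ?thesis by (simp add: sum_distrib_left mult_ac)
      qed
      ultimately have F: "(?F has_integral (of_real (Gamma \<sigma>) * P N)) {0..}" by simp
      have B: "(?B has_integral (C0 * A * (I * \<delta> powr (\<sigma> - a)) + \<epsilon> N * Gamma \<sigma>)) {0..}"
        unfolding I_def
        by (intro has_integral_add has_integral_mult_right two_regime_integral Gamma_integral_real \<sigma> \<delta>)
      have "norm (of_real (Gamma \<sigma>) * P N) \<le> (C0 * A * (I * \<delta> powr (\<sigma> - a)) + \<epsilon> N * Gamma \<sigma>) \<bullet> 1"
      proof (rule has_integral_norm_bound_integral_component[OF F B])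
        fix t :: real assume "t \<in> {0..}"
        then consider "t = 0" | "t > 0" by fastforce
        then show "norm (?F t) \<le> ?B t \<bullet> 1"
        proof cases
          case 1
          then show ?thesis using \<delta> by simp
        next
          case 2
          have "?F t = of_real (t powr (\<sigma> - 1)) * (\<Sum>j\<in>{1..<N}. H j * of_real (exp (- real j * t)))"
            by (simp add: sum_distrib_left mult_ac)
          then have "norm (?F t) = t powr (\<sigma> - 1) * norm (\<Sum>j\<in>{1..<N}. H j * of_real (exp (- real j * t)))"
            by (simp add: norm_mult)
          also have "\<dots> \<le> t powr (\<sigma> - 1) *
              (C0 * A * (if t \<le> \<delta> then \<delta> powr (-a) else K * t powr (-a)) + \<epsilon> N * exp (-t))"
            by (intro mult_left_mono pointwise 2 N) auto
          also have "\<dots> = ?B t"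
          proof -
            have "t powr (\<sigma> - 1 - a) = t powr (\<sigma> - 1) * t powr (-a)" by (simp flip: powr_add)
            then show ?thesis by (simp add: exp_minus divide_inverse algebra_simps)
          qed
          finally show ?thesis by simp
        qed
      qed
      then show ?thesis using G by (simp add: norm_mult)
    qed
    have "P \<longlonglongrightarrow> hmult (\<lambda>j. real j powr (-\<sigma>)) h z"
      using hmult_sums[OF h subexponential_powr z] by (simp add: sums_def P_def[abs_def] H_def)
    then have "(\<lambda>N. Gamma \<sigma> * norm (P N)) \<longlonglongrightarrow> Gamma \<sigma> * norm (hmult (\<lambda>j. real j powr (-\<sigma>)) h z)"
      by (intro tendsto_intros)
    moreover have "(\<lambda>N. C0 * A * (I * \<delta> powr (\<sigma> - a)) + \<epsilon> N * Gamma \<sigma>) \<longlonglongrightarrow> C0 * A * (I * \<delta> powr (\<sigma> - a)) + 0 * Gamma \<sigma>"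
      by (intro tendsto_intros \<epsilon>_lim)
    ultimately have "Gamma \<sigma> * norm (hmult (\<lambda>j. real j powr (-\<sigma>)) h z) \<le> C0 * A * (I * \<delta> powr (\<sigma> - a)) + 0 * Gamma \<sigma>"
      by (rule LIMSEQ_le) (use bound in blast)
    then show "norm (hmult (\<lambda>j. real j powr (-\<sigma>)) h z) \<le> C0 * I / Gamma \<sigma> * A * (1 - (norm z)\<^sup>2) powr (- (a - \<sigma>))"
      using G by (simp add: \<delta>_def field_simps)
  qed
  then show ?thesis using C0 I G by (intro exI[of _ "C0 * I / Gamma \<sigma>"]) auto
qed

text \<open>Any real \<open>s\<close> is a natural number \<open>N > s\<close> minus some \<open>\<sigma> > 0\<close>; the order of growth first rises to
\<open>a + N\<close>, which exceeds \<open>\<sigma>\<close> exactly because \<open>a + s > 0\<close>.\<close>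

lemma growth_hmult_powr:
  fixes a s :: real
  assumes a: "a > 0" "a + s > 0"
  shows "\<exists>C\<ge>0. \<forall>(h :: complex ^ 'n \<Rightarrow> complex) A. holo_on h unit_ball \<longrightarrow> growth a A h \<longrightarrow>
           growth (a + s) (C * A) (hmult (\<lambda>j. real j powr s) h)"
proof -
  obtain N :: nat where N: "real N > s" using reals_Archimedean2 by blast
  define \<sigma> where "\<sigma> = real N - s"
  obtain C1 where C1: "C1 \<ge> 0" "\<And>(h :: complex ^ 'n \<Rightarrow> complex) A. holo_on h unit_ball \<Longrightarrow> growth a A h \<Longrightarrow>
           growth (a + real N) (C1 * A) ((radial_deriv ^^ N) h)"
    using growth_radial_deriv_iter[of a N] a by auto
  obtain C2 where C2: "C2 \<ge> 0" "\<And>(h :: complex ^ 'n \<Rightarrow> complex) A. holo_on h unit_ball \<Longrightarrow> growth (a + real N) A h \<Longrightarrow>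
           growth (a + real N - \<sigma>) (C2 * A) (hmult (\<lambda>j. real j powr (-\<sigma>)) h)"
    using growth_hmult_negative[of \<sigma> "a + real N"] a N by (auto simp: \<sigma>_def)
  have "growth (a + s) (C2 * C1 * A) (hmult (\<lambda>j. real j powr s) h)"
    if h: "holo_on h unit_ball" and gr: "growth a A h" for h :: "complex ^ 'n \<Rightarrow> complex" and A
  proof -
    have "real j powr (-\<sigma>) * real j ^ N = real j powr s" for j
      by (cases "j = 0") (auto simp: \<sigma>_def powr_diff powr_realpow)
    then have "complex_of_real (real j powr (-\<sigma>)) * of_nat j ^ N = of_real (real j powr s)" for j
      by (metis of_real_mult of_real_of_nat_eq of_real_power)
    then have eq: "complex_of_real (real j powr (-\<sigma>)) * (of_nat j ^ N * x) = of_real (real j powr s) * x" for j x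
      by (simp only: mult.assoc[symmetric])
    have "hmult (\<lambda>j. real j powr (-\<sigma>)) ((radial_deriv ^^ N) h) = hmult (\<lambda>j. real j powr s) h"
      by (rule ext) (simp only: hmult_def hpart_radial_deriv_iter[OF h] eq)
    then show ?thesis
      using C2(2)[OF holo_on_radial_deriv_iter[OF h] C1(2)[OF h gr]] by (simp add: \<sigma>_def mult.assoc)
  qed
  then show ?thesis using C1(1) C2(1) by (intro exI[of _ "C2 * C1"]) auto
qed


section \<open>The coefficient multiplier\<close>

text \<open>The multiplier of \<open>coeff_multiplier\<close>, which keeps the constant term, in contrast to \<open>j powr s\<close>.\<close>

definition mult_seq :: "real \<Rightarrow> nat \<Rightarrow> real" where
  "mult_seq s j = (if j = 0 then 1 else real j powr s)"

lemma subexponential_mult_seq: "subexponential (mult_seq s)"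
  unfolding subexponential_def
proof (intro allI impI)
  fix q :: real assume q: "0 < q" "q < 1"
  have "summable (\<lambda>j. \<bar>real j powr s\<bar> * q ^ j)"
    using subexponential_powr q unfolding subexponential_def by blast
  moreover have "\<forall>\<^sub>F j in sequentially. \<bar>real j powr s\<bar> * q ^ j = \<bar>mult_seq s j\<bar> * q ^ j"
    using eventually_gt_at_top[of 0] by eventually_elim (simp add: mult_seq_def)
  ultimately show "summable (\<lambda>j. \<bar>mult_seq s j\<bar> * q ^ j)"
    by (simp only: summable_cong)
qed

lemma coeff_multiplier_eq_hmult:
  fixes f :: "complex ^ 'n \<Rightarrow> complex"
  assumes f: "holo_on f unit_ball" and z: "z \<in> unit_ball"
  shows "coeff_multiplier \<alpha> \<beta> f z = hmult (mult_seq (\<alpha> - \<beta>)) f z"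
proof -
  let ?s = "\<alpha> - \<beta>"
  have "((\<lambda>m. taylor_coeffs f m * complex_of_real (real (mi_size m) powr ?s) * mi_power z m)
      has_sum hmult (\<lambda>j. real j powr ?s) f z) UNIV"
    using hmult_has_sum[OF f subexponential_powr z, of ?s] by (simp add: mult_ac)
  then have "((\<lambda>m. taylor_coeffs f m * complex_of_real (real (mi_size m) powr ?s) * mi_power z m)
      has_sum hmult (\<lambda>j. real j powr ?s) f z) {m. mi_size m > 0}"
    by (rule has_sum_cong_neutral[THEN iffD1, rotated -1]) auto
  then have "coeff_multiplier \<alpha> \<beta> f z = f 0 + hmult (\<lambda>j. real j powr ?s) f z"
    using z unfolding coeff_multiplier_def by (simp add: infsumI)
  moreover have "(\<lambda>j. (if j = 0 then f 0 else 0) + of_real (real j powr ?s) * hpart f j z) sums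
      (f 0 + hmult (\<lambda>j. real j powr ?s) f z)"
    by (intro sums_add hmult_sums f z subexponential_powr sums_single)
  moreover have "(if j = 0 then f 0 else 0) + of_real (real j powr ?s) * hpart f j z =
      of_real (mult_seq ?s j) * hpart f j z" for j
    by (simp add: mult_seq_def hpart_0[OF f])
  ultimately show ?thesis by (simp add: hmult_def sums_iff)
qed

lemma holo_on_coeff_multiplier:
  fixes f :: "complex ^ 'n \<Rightarrow> complex"
  assumes "holo_on f unit_ball"
  shows "holo_on (coeff_multiplier \<alpha> \<beta> f) unit_ball"
  by (rule holo_on_cong[OF _ _ holo_on_hmult[OF assms subexponential_mult_seq[of "\<alpha> - \<beta>"]]])
     (use coeff_multiplier_eq_hmult[OF assms] in auto)

lemma hpart_coeff_multiplier:
  fixes f :: "complex ^ 'n \<Rightarrow> complex"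
  assumes "holo_on f unit_ball"
  shows "hpart (coeff_multiplier \<alpha> \<beta> f) j z = of_real (mult_seq (\<alpha> - \<beta>) j) * hpart f j z"
  using hpart_hmult[OF assms subexponential_mult_seq[of "\<alpha> - \<beta>"], of j z]
  by (subst hpart_cong[of _ "hmult (mult_seq (\<alpha> - \<beta>)) f"])
     (use coeff_multiplier_eq_hmult[OF assms] in auto)

lemma coeff_multiplier_at_0: "coeff_multiplier \<alpha> \<beta> f 0 = f 0"
proof -
  have "(\<Sum>\<^sub>\<infinity>m\<in>{m. mi_size m > 0}.
      taylor_coeffs f m * complex_of_real (real (mi_size m) powr (\<alpha> - \<beta>)) * mi_power 0 m) = 0"
    by (rule infsum_0) (auto simp: mi_power_def mi_size_def power_0_left)
  then show ?thesis by (simp add: coeff_multiplier_def)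
qed

lemma coeff_multiplier_inverse:
  fixes f :: "complex ^ 'n \<Rightarrow> complex"
  assumes f: "holo_on f unit_ball" and out: "\<And>z. z \<notin> unit_ball \<Longrightarrow> f z = 0"
  shows "coeff_multiplier \<beta> \<alpha> (coeff_multiplier \<alpha> \<beta> f) = f"
proof
  fix z
  show "coeff_multiplier \<beta> \<alpha> (coeff_multiplier \<alpha> \<beta> f) z = f z"
  proof (cases "z \<in> unit_ball")
    case True
    have one: "mult_seq (\<beta> - \<alpha>) j * mult_seq (\<alpha> - \<beta>) j = 1" for j
      by (simp add: mult_seq_def flip: powr_add)
    have "complex_of_real (mult_seq (\<beta> - \<alpha>) j) * (of_real (mult_seq (\<alpha> - \<beta>) j) * x) = x" for j x
      using arg_cong[OF one[of j], of complex_of_real] by (simp flip: mult.assoc)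
    then have "coeff_multiplier \<beta> \<alpha> (coeff_multiplier \<alpha> \<beta> f) z = (\<Sum>j. hpart f j z)"
      by (simp only: coeff_multiplier_eq_hmult[OF holo_on_coeff_multiplier[OF f] True] hmult_def
          hpart_coeff_multiplier[OF f])
    then show ?thesis using sums_unique[OF hpart_sums[OF f True]] by simp
  next
    case False
    then show ?thesis using out by (simp add: coeff_multiplier_def)
  qed
qed

lemma radial_deriv_iter_sums:
  fixes f :: "complex ^ 'n \<Rightarrow> complex"
  assumes f: "holo_on f unit_ball" and z: "z \<in> unit_ball"
  shows "(\<lambda>j. of_nat j ^ k * hpart f j z) sums (radial_deriv ^^ k) f z"
  using hpart_sums[OF holo_on_radial_deriv_iter[OF f, of k] z]
  by (simp only: hpart_radial_deriv_iter[OF f])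

text \<open>Comparison of the multipliers \<open>j\<^sup>l * j powr (\<alpha> - \<beta>)\<close> and \<open>j powr u * j\<^sup>k\<close>, which agree for
\<open>j > 0\<close>. The constant term survives on the left only if \<open>l = 0\<close>, since \<open>0\<^sup>0 = 1\<close>.\<close>

lemma radial_deriv_iter_coeff_multiplier:
  fixes f :: "complex ^ 'n \<Rightarrow> complex"
  assumes f: "holo_on f unit_ball" and z: "z \<in> unit_ball"
  shows "(radial_deriv ^^ l) (coeff_multiplier \<alpha> \<beta> f) z =
           0 ^ l * f 0 + hmult (\<lambda>j. real j powr (real l + (\<alpha> - \<beta>) - real k)) ((radial_deriv ^^ k) f) z"
proof -
  define u where "u = real l + (\<alpha> - \<beta>) - real k"
  have coeff: "real j ^ l * mult_seq (\<alpha> - \<beta>) j = (if j = 0 then 0 ^ l else 0) + real j powr u * real j ^ k" for j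
    by (simp add: mult_seq_def u_def powr_add powr_diff powr_realpow)
  have coeff': "of_nat j ^ l * (complex_of_real (mult_seq (\<alpha> - \<beta>) j) * x) =
      (if j = 0 then 0 ^ l * x else 0) + of_real (real j powr u) * (of_nat j ^ k * x)" for j x
    using arg_cong[OF coeff[of j], of "\<lambda>r. complex_of_real r * x"] by (auto simp: algebra_simps)
  have "(\<lambda>j. of_nat j ^ l * (of_real (mult_seq (\<alpha> - \<beta>) j) * hpart f j z)) sums
      (radial_deriv ^^ l) (coeff_multiplier \<alpha> \<beta> f) z"
    using radial_deriv_iter_sums[OF holo_on_coeff_multiplier[OF f] z] by (simp only: hpart_coeff_multiplier[OF f])
  moreover have "(\<lambda>j. (if j = 0 then 0 ^ l * hpart f j z else 0) + of_real (real j powr u) * (of_nat j ^ k * hpart f j z)) sums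
      (0 ^ l * hpart f 0 z + hmult (\<lambda>j. real j powr u) ((radial_deriv ^^ k) f) z)"
    using hmult_sums[OF holo_on_radial_deriv_iter[OF f, of k] subexponential_powr z, of u]
    by (intro sums_add sums_single) (simp only: hpart_radial_deriv_iter[OF f])
  ultimately show ?thesis
    unfolding coeff' using sums_unique2 by (fastforce simp: u_def hpart_0[OF f])
qed

lemma growth_coeff_multiplier:
  fixes \<alpha> \<beta> :: real and k l :: nat
  assumes k: "real k > \<alpha>" and l: "real l > \<beta>"
  shows "\<exists>C\<ge>0. \<forall>(f :: complex ^ 'n \<Rightarrow> complex) A. holo_on f unit_ball \<longrightarrow>
           growth (real k - \<alpha>) A ((radial_deriv ^^ k) f) \<longrightarrow>
           growth (real l - \<beta>) (norm (f 0) + C * A) ((radial_deriv ^^ l) (coeff_multiplier \<alpha> \<beta> f))"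
proof -
  define u where "u = real l + (\<alpha> - \<beta>) - real k"
  have "(real k - \<alpha>) + u = real l - \<beta>" by (simp add: u_def)
  then obtain C where C: "C \<ge> 0" "\<And>(h :: complex ^ 'n \<Rightarrow> complex) A. holo_on h unit_ball \<Longrightarrow>
      growth (real k - \<alpha>) A h \<Longrightarrow> growth (real l - \<beta>) (C * A) (hmult (\<lambda>j. real j powr u) h)"
    using growth_hmult_powr[of "real k - \<alpha>" u] k l by auto
  have "growth (real l - \<beta>) (norm (f 0) + C * A) ((radial_deriv ^^ l) (coeff_multiplier \<alpha> \<beta> f))"
    if f: "holo_on f unit_ball" and gr: "growth (real k - \<alpha>) A ((radial_deriv ^^ k) f)"
    for f :: "complex ^ 'n \<Rightarrow> complex" and A
    unfolding growth_def
  proof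
    fix z :: "complex ^ 'n" assume z: "z \<in> unit_ball"
    define p where "p = (1 - (norm z)\<^sup>2) powr (- (real l - \<beta>))"
    have p: "p \<ge> 1"
      unfolding p_def using powr_mono2'[of "- (real l - \<beta>)" "1 - (norm z)\<^sup>2" 1] one_minus_norm_sq_pos[OF z] l by simp
    let ?g = "hmult (\<lambda>j. real j powr u) ((radial_deriv ^^ k) f) z"
    have "norm ((radial_deriv ^^ l) (coeff_multiplier \<alpha> \<beta> f) z) \<le> norm (0 ^ l * f 0) + norm ?g"
      unfolding radial_deriv_iter_coeff_multiplier[OF f z, of l \<alpha> \<beta> k] u_def by (rule norm_triangle_ineq)
    also have "norm (0 ^ l * f 0) \<le> norm (f 0) * 1"
      by (cases "l = 0") (auto simp: power_0_left)
    also have "norm (f 0) * 1 \<le> norm (f 0) * p" using p by (intro mult_left_mono) auto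
    also have "norm ?g \<le> C * A * p"
      using C(2)[OF holo_on_radial_deriv_iter[OF f] gr] z by (simp add: growth_def p_def)
    finally show "norm ((radial_deriv ^^ l) (coeff_multiplier \<alpha> \<beta> f) z) \<le>
        (norm (f 0) + C * A) * (1 - (norm z)\<^sup>2) powr (- (real l - \<beta>))"
      by (simp add: p_def algebra_simps)
  qed
  then show ?thesis using C(1) by blast
qed

section \<open>Lipschitz spaces\<close>

abbreviation least_order :: "real \<Rightarrow> nat" where
  "least_order \<alpha> \<equiv> (LEAST k. real k > \<alpha>)"

lemma least_order_gt: "real (least_order \<alpha>) > \<alpha>"
  using LeastI_ex[OF reals_Archimedean2[of \<alpha>]] .

lemma growth_iff_weighted:
  "growth a A h \<longleftrightarrow> (\<forall>z\<in>unit_ball. (1 - (norm z)\<^sup>2) powr a * norm (h z) \<le> A)"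
proof -
  have "norm (h z) \<le> A * (1 - (norm z)\<^sup>2) powr (-a) \<longleftrightarrow> (1 - (norm z)\<^sup>2) powr a * norm (h z) \<le> A"
    if "z \<in> unit_ball" for z
    using one_minus_norm_sq_pos[OF that] by (simp add: powr_minus field_simps)
  then show ?thesis unfolding growth_def by blast
qed

lemma bounded_iff_growth:
  "bounded ((\<lambda>z. complex_of_real ((1 - (norm z)\<^sup>2) powr a) * h z) ` unit_ball) \<longleftrightarrow> (\<exists>A. growth a A h)"
  by (simp add: bounded_iff growth_iff_weighted norm_mult)

text \<open>Independence of the order: the coefficient multiplier with equal parameters is the identity, so
\<open>growth_coeff_multiplier\<close> transfers the bound from any order \<open>k > \<alpha>\<close> to the least one, which is the
order used by the norm.\<close>

lemma Lipschitz_space_iff: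
  fixes f :: "complex ^ 'n \<Rightarrow> complex"
  shows "f \<in> Lipschitz_space \<alpha> \<longleftrightarrow> holo_on f unit_ball \<and> (\<forall>z. z \<notin> unit_ball \<longrightarrow> f z = 0) \<and>
           (\<exists>A. growth (real (least_order \<alpha>) - \<alpha>) A ((radial_deriv ^^ least_order \<alpha>) f))"
    (is "_ \<longleftrightarrow> ?rhs")
proof
  assume "f \<in> Lipschitz_space \<alpha>"
  then obtain k A where f: "holo_on f unit_ball" "\<And>z. z \<notin> unit_ball \<Longrightarrow> f z = 0"
    and k: "real k > \<alpha>" "growth (real k - \<alpha>) A ((radial_deriv ^^ k) f)"
    unfolding Lipschitz_space_def bounded_iff_growth by blast
  have T: "coeff_multiplier \<alpha> \<alpha> f = f"
  proof
    fix z show "coeff_multiplier \<alpha> \<alpha> f z = f z"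
    proof (cases "z \<in> unit_ball")
      case True
      have "mult_seq 0 = (\<lambda>_. 1)" by (simp add: mult_seq_def fun_eq_iff)
      then show ?thesis
        using coeff_multiplier_eq_hmult[OF f(1) True, of \<alpha> \<alpha>] sums_unique[OF hpart_sums[OF f(1) True]]
        by (simp add: hmult_def)
    qed (use f(2) in \<open>simp add: coeff_multiplier_def\<close>)
  qed
  obtain C where "growth (real (least_order \<alpha>) - \<alpha>) (norm (f 0) + C * A)
      ((radial_deriv ^^ least_order \<alpha>) (coeff_multiplier \<alpha> \<alpha> f))"
    using growth_coeff_multiplier[OF k(1) least_order_gt] f(1) k(2) by blast
  then show ?rhs unfolding T using f by blast
next
  assume ?rhs
  then show "f \<in> Lipschitz_space \<alpha>"
    unfolding Lipschitz_space_def bounded_iff_growth using least_order_gt by blast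
qed

lemma growth_Lipschitz_norm:
  fixes f :: "complex ^ 'n \<Rightarrow> complex"
  assumes "f \<in> Lipschitz_space \<alpha>"
  shows "growth (real (least_order \<alpha>) - \<alpha>) (Lipschitz_norm \<alpha> f - norm (f 0)) ((radial_deriv ^^ least_order \<alpha>) f)"
proof -
  obtain A where A: "growth (real (least_order \<alpha>) - \<alpha>) A ((radial_deriv ^^ least_order \<alpha>) f)"
    using assms Lipschitz_space_iff by blast
  let ?w = "\<lambda>z. (1 - (norm z)\<^sup>2) powr (real (least_order \<alpha>) - \<alpha>) * norm ((radial_deriv ^^ least_order \<alpha>) f z)"
  have "bdd_above (?w ` unit_ball)"
    using A unfolding growth_iff_weighted by (intro bdd_aboveI[of _ A]) auto
  then have "?w z \<le> (SUP z\<in>unit_ball. ?w z)" if "z \<in> unit_ball" for z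
    using that by (intro cSUP_upper)
  then show ?thesis by (simp add: growth_iff_weighted Lipschitz_norm_def Let_def)
qed

lemma Lipschitz_norm_le:
  fixes f :: "complex ^ 'n \<Rightarrow> complex"
  assumes "growth (real (least_order \<alpha>) - \<alpha>) A ((radial_deriv ^^ least_order \<alpha>) f)"
  shows "Lipschitz_norm \<alpha> f \<le> norm (f 0) + A"
proof -
  have "(SUP z\<in>unit_ball. (1 - (norm z)\<^sup>2) powr (real (least_order \<alpha>) - \<alpha>) *
          norm ((radial_deriv ^^ least_order \<alpha>) f z)) \<le> A"
    using assms unfolding growth_iff_weighted by (intro cSUP_least) auto
  then show ?thesis by (simp add: Lipschitz_norm_def Let_def)
qed

lemma taylor_coeffs_add:
  fixes f g :: "complex ^ 'n \<Rightarrow> complex"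
  assumes "holo_on f unit_ball" "holo_on g unit_ball"
  shows "taylor_coeffs (\<lambda>z. f z + g z) = (\<lambda>m. taylor_coeffs f m + taylor_coeffs g m)"
  by (rule taylor_coeffs_eqI)
     (use has_sum_add[OF taylor_has_sum[OF assms(1)] taylor_has_sum[OF assms(2)]] in \<open>auto simp: distrib_right\<close>)

lemma taylor_coeffs_cmult:
  fixes f :: "complex ^ 'n \<Rightarrow> complex"
  assumes "holo_on f unit_ball"
  shows "taylor_coeffs (\<lambda>z. c * f z) = (\<lambda>m. c * taylor_coeffs f m)"
  by (rule taylor_coeffs_eqI)
     (use has_sum_cmult_right[OF taylor_has_sum[OF assms], of _ c] in \<open>auto simp: mult.assoc\<close>)

lemma hpart_add:
  fixes f g :: "complex ^ 'n \<Rightarrow> complex"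
  assumes "holo_on f unit_ball" "holo_on g unit_ball"
  shows "hpart (\<lambda>z. f z + g z) j z = hpart f j z + hpart g j z"
  by (simp add: hpart_def taylor_coeffs_add[OF assms] distrib_right sum.distrib)

lemma hpart_cmult:
  fixes f :: "complex ^ 'n \<Rightarrow> complex"
  assumes "holo_on f unit_ball"
  shows "hpart (\<lambda>z. c * f z) j z = c * hpart f j z"
  by (simp add: hpart_def taylor_coeffs_cmult[OF assms] sum_distrib_left mult.assoc)

lemma holo_on_cmult: "holo_on f S \<Longrightarrow> holo_on (\<lambda>z. c * f z) S"
  by (intro holo_on_mult holo_on_const)

lemma coeff_multiplier_add:
  fixes f g :: "complex ^ 'n \<Rightarrow> complex"
  assumes f: "holo_on f unit_ball" and g: "holo_on g unit_ball"
  shows "coeff_multiplier \<alpha> \<beta> (\<lambda>z. f z + g z) = (\<lambda>z. coeff_multiplier \<alpha> \<beta> f z + coeff_multiplier \<alpha> \<beta> g z)"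
proof
  fix z :: "complex ^ 'n"
  show "coeff_multiplier \<alpha> \<beta> (\<lambda>z. f z + g z) z = coeff_multiplier \<alpha> \<beta> f z + coeff_multiplier \<alpha> \<beta> g z"
  proof (cases "z \<in> unit_ball")
    case True
    let ?c = "mult_seq (\<alpha> - \<beta>)"
    have "(\<lambda>j. of_real (?c j) * hpart f j z + of_real (?c j) * hpart g j z) sums (hmult ?c f z + hmult ?c g z)"
      by (intro sums_add hmult_sums f g True subexponential_mult_seq)
    then have "hmult ?c (\<lambda>z. f z + g z) z = hmult ?c f z + hmult ?c g z"
      unfolding hmult_def[of ?c "\<lambda>z. f z + g z"] hpart_add[OF f g] distrib_left by (rule sums_unique[symmetric])
    then show ?thesis
      by (simp only: coeff_multiplier_eq_hmult[OF f True] coeff_multiplier_eq_hmult[OF g True]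
          coeff_multiplier_eq_hmult[OF holo_on_add[OF f g] True])
  qed (simp add: coeff_multiplier_def)
qed

lemma coeff_multiplier_cmult:
  fixes f :: "complex ^ 'n \<Rightarrow> complex"
  assumes f: "holo_on f unit_ball"
  shows "coeff_multiplier \<alpha> \<beta> (\<lambda>z. c * f z) = (\<lambda>z. c * coeff_multiplier \<alpha> \<beta> f z)"
proof
  fix z :: "complex ^ 'n"
  show "coeff_multiplier \<alpha> \<beta> (\<lambda>z. c * f z) z = c * coeff_multiplier \<alpha> \<beta> f z"
  proof (cases "z \<in> unit_ball")
    case True
    let ?c = "mult_seq (\<alpha> - \<beta>)"
    have "(\<lambda>j. c * (of_real (?c j) * hpart f j z)) sums (c * hmult ?c f z)"
      by (intro sums_mult hmult_sums f True subexponential_mult_seq)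
    then have "hmult ?c (\<lambda>z. c * f z) z = c * hmult ?c f z"
      unfolding hmult_def[of ?c "\<lambda>z. c * f z"] hpart_cmult[OF f] mult.left_commute[of c] by (rule sums_unique[symmetric])
    then show ?thesis
      by (simp only: coeff_multiplier_eq_hmult[OF f True] coeff_multiplier_eq_hmult[OF holo_on_cmult[OF f] True])
  qed (simp add: coeff_multiplier_def)
qed

lemma radial_deriv_iter_add:
  fixes f g :: "complex ^ 'n \<Rightarrow> complex"
  assumes f: "holo_on f unit_ball" and g: "holo_on g unit_ball" and z: "z \<in> unit_ball"
  shows "(radial_deriv ^^ k) (\<lambda>z. f z + g z) z = (radial_deriv ^^ k) f z + (radial_deriv ^^ k) g z"
  using radial_deriv_iter_sums[OF holo_on_add[OF f g] z, of k]
    sums_add[OF radial_deriv_iter_sums[OF f z, of k] radial_deriv_iter_sums[OF g z, of k]]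
  unfolding hpart_add[OF f g] distrib_left by (rule sums_unique2)

lemma radial_deriv_iter_cmult:
  fixes f :: "complex ^ 'n \<Rightarrow> complex"
  assumes f: "holo_on f unit_ball" and z: "z \<in> unit_ball"
  shows "(radial_deriv ^^ k) (\<lambda>z. c * f z) z = c * (radial_deriv ^^ k) f z"
  using radial_deriv_iter_sums[OF holo_on_cmult[OF f] z, of k c]
    sums_mult[OF radial_deriv_iter_sums[OF f z, of k], of c]
  unfolding hpart_cmult[OF f] mult.left_commute[of c] by (rule sums_unique2)

lemma Lipschitz_space_add:
  fixes f g :: "complex ^ 'n \<Rightarrow> complex"
  assumes "f \<in> Lipschitz_space \<alpha>" "g \<in> Lipschitz_space \<alpha>"
  shows "(\<lambda>z. f z + g z) \<in> Lipschitz_space \<alpha>"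
proof -
  let ?k = "least_order \<alpha>"
  obtain A B where A: "growth (real ?k - \<alpha>) A ((radial_deriv ^^ ?k) f)"
    and B: "growth (real ?k - \<alpha>) B ((radial_deriv ^^ ?k) g)"
    and f: "holo_on f unit_ball" "\<And>z. z \<notin> unit_ball \<Longrightarrow> f z = 0"
    and g: "holo_on g unit_ball" "\<And>z. z \<notin> unit_ball \<Longrightarrow> g z = 0"
    using assms unfolding Lipschitz_space_iff by blast
  have "growth (real ?k - \<alpha>) (A + B) ((radial_deriv ^^ ?k) (\<lambda>z. f z + g z))"
    unfolding growth_def
  proof
    fix z :: "complex ^ 'n" assume z: "z \<in> unit_ball"
    have "norm ((radial_deriv ^^ ?k) f z + (radial_deriv ^^ ?k) g z) \<le>
        norm ((radial_deriv ^^ ?k) f z) + norm ((radial_deriv ^^ ?k) g z)" by (rule norm_triangle_ineq)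
    then show "norm ((radial_deriv ^^ ?k) (\<lambda>z. f z + g z) z) \<le> (A + B) * (1 - (norm z)\<^sup>2) powr - (real ?k - \<alpha>)"
      using A B z unfolding growth_def radial_deriv_iter_add[OF f(1) g(1) z] distrib_right
      by (meson add_mono order_trans)
  qed
  then show ?thesis unfolding Lipschitz_space_iff using holo_on_add[OF f(1) g(1)] f(2) g(2) by auto
qed

lemma Lipschitz_space_cmult:
  fixes f :: "complex ^ 'n \<Rightarrow> complex"
  assumes "f \<in> Lipschitz_space \<alpha>"
  shows "(\<lambda>z. c * f z) \<in> Lipschitz_space \<alpha>"
proof -
  let ?k = "least_order \<alpha>"
  obtain A where A: "growth (real ?k - \<alpha>) A ((radial_deriv ^^ ?k) f)"
    and f: "holo_on f unit_ball" "\<And>z. z \<notin> unit_ball \<Longrightarrow> f z = 0"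
    using assms unfolding Lipschitz_space_iff by blast
  have "growth (real ?k - \<alpha>) (norm c * A) ((radial_deriv ^^ ?k) (\<lambda>z. c * f z))"
    using A unfolding growth_def
    by (auto simp: radial_deriv_iter_cmult[OF f(1)] norm_mult mult.assoc intro!: mult_left_mono)
  then show ?thesis unfolding Lipschitz_space_iff using holo_on_cmult[OF f(1)] f(2) by auto
qed

lemma bounded_operator_coeff_multiplier:
  "bounded_operator
     (Lipschitz_space \<alpha> :: (complex ^ 'n \<Rightarrow> complex) set) (Lipschitz_norm \<alpha>)
     (Lipschitz_space \<beta> :: (complex ^ 'n \<Rightarrow> complex) set) (Lipschitz_norm \<beta>)
     (coeff_multiplier \<alpha> \<beta>)"
proof -
  let ?V = "Lipschitz_space \<alpha> :: (complex ^ 'n \<Rightarrow> complex) set"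
  let ?k = "least_order \<alpha>" and ?l = "least_order \<beta>"
  have holo: "holo_on f unit_ball" if "f \<in> ?V" for f using that Lipschitz_space_iff by blast
  obtain C where C: "C \<ge> 0" "\<And>(f :: complex ^ 'n \<Rightarrow> complex) A. holo_on f unit_ball \<Longrightarrow>
           growth (real ?k - \<alpha>) A ((radial_deriv ^^ ?k) f) \<Longrightarrow>
           growth (real ?l - \<beta>) (norm (f 0) + C * A) ((radial_deriv ^^ ?l) (coeff_multiplier \<alpha> \<beta> f))"
    using growth_coeff_multiplier[OF least_order_gt[of \<alpha>] least_order_gt[of \<beta>]] by blast
  have gr: "growth (real ?l - \<beta>) (norm (f 0) + C * (Lipschitz_norm \<alpha> f - norm (f 0)))
      ((radial_deriv ^^ ?l) (coeff_multiplier \<alpha> \<beta> f))" if "f \<in> ?V" for f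
    by (rule C(2)[OF holo[OF that] growth_Lipschitz_norm[OF that]])
  have "coeff_multiplier \<alpha> \<beta> f \<in> Lipschitz_space \<beta>" if "f \<in> ?V" for f
    unfolding Lipschitz_space_iff
    using gr[OF that] holo_on_coeff_multiplier[OF holo[OF that]] by (auto simp: coeff_multiplier_def)
  moreover have "Lipschitz_norm \<beta> (coeff_multiplier \<alpha> \<beta> f) \<le> (2 + C) * Lipschitz_norm \<alpha> f" if f: "f \<in> ?V" for f
  proof -
    define S where "S = Lipschitz_norm \<alpha> f - norm (f 0)"
    have S: "S \<ge> 0" unfolding S_def by (rule growth_nonneg[OF growth_Lipschitz_norm[OF f]])
    have "Lipschitz_norm \<beta> (coeff_multiplier \<alpha> \<beta> f) \<le> norm (f 0) + (norm (f 0) + C * S)"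
      using Lipschitz_norm_le[OF gr[OF f]] by (simp add: coeff_multiplier_at_0 S_def)
    also have "\<dots> \<le> (2 + C) * (norm (f 0) + S)"
      using C(1) S by (simp add: algebra_simps)
    finally show ?thesis by (simp add: S_def)
  qed
  ultimately show ?thesis
    unfolding bounded_operator_def
    by (intro conjI ballI allI exI[of _ "2 + C"] coeff_multiplier_add coeff_multiplier_cmult holo)
qed

theorem theorem60:
  fixes \<alpha> \<beta> :: real
  shows "invertible_operator
           (Lipschitz_space \<alpha> :: (complex ^ 'n \<Rightarrow> complex) set) (Lipschitz_norm \<alpha>)
           (Lipschitz_space \<beta> :: (complex ^ 'n \<Rightarrow> complex) set) (Lipschitz_norm \<beta>)
           (coeff_multiplier \<alpha> \<beta>)"
proof -
  let ?V = "Lipschitz_space \<alpha> :: (complex ^ 'n \<Rightarrow> complex) set"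
  let ?W = "Lipschitz_space \<beta> :: (complex ^ 'n \<Rightarrow> complex) set"
  let ?T = "coeff_multiplier \<alpha> \<beta> :: (complex ^ 'n \<Rightarrow> complex) \<Rightarrow> _"
  let ?S = "coeff_multiplier \<beta> \<alpha> :: (complex ^ 'n \<Rightarrow> complex) \<Rightarrow> _"
  note T = bounded_operator_coeff_multiplier[of \<alpha> \<beta>, where 'n = 'n]
  note S = bounded_operator_coeff_multiplier[of \<beta> \<alpha>, where 'n = 'n]
  have TV: "?T f \<in> ?W" if "f \<in> ?V" for f using T that unfolding bounded_operator_def by blast
  have SW: "?S g \<in> ?V" if "g \<in> ?W" for g using S that unfolding bounded_operator_def by blast
  have ST: "?S (?T f) = f" if "f \<in> ?V" for f
    using that unfolding Lipschitz_space_iff by (intro coeff_multiplier_inverse) auto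
  have TS: "?T (?S g) = g" if "g \<in> ?W" for g
    using that unfolding Lipschitz_space_iff by (intro coeff_multiplier_inverse) auto
  have bij: "bij_betw ?T ?V ?W"
    by (rule bij_betw_byWitness[where f' = ?S]) (use TV SW ST TS in auto)
  have inv: "inv_into ?V ?T g = ?S g" if "g \<in> ?W" for g
    using inv_into_f_f[OF bij_betw_imp_inj_on[OF bij] SW[OF that]] TS[OF that] by simp
  have "bounded_operator ?W (Lipschitz_norm \<beta>) ?V (Lipschitz_norm \<alpha>) (inv_into ?V ?T)"
    using S unfolding bounded_operator_def by (simp add: inv Lipschitz_space_add Lipschitz_space_cmult)
  then show ?thesis using T bij unfolding invertible_operator_def by blast
qed

end
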